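(* Let $X\in\mathcal{X}$ be a real-valued continuous random variable with cumulative distribution function $F$, and let $q_0<q_n$ be two fixed real numbers (not depending on $n$ or $N$; $q_n$ denotes the fixed right endpoint) which serve as the points $x_1=q_0$ and $x_2=q_n$ in the definition of $\mathcal{X}$ for $X$. Then there exists a family $\{f_{N,n}\}$, each element $f_{N,n}$ of which is a PDF of the three-segment form with tail degree $N$, with $n$ intermediate subintervals, and with these fixed endpoints $q_0,q_n$, such that $$\lim_{n,N\to\infty}\Big\Vert F(x)-\int_{-\infty}^{x}f_{N,n}(t)\,\mathrm{d}t\Big\Vert_{L^2(\mathbb{R})}=0$$ and $$\lim_{n,N\to\infty}\Big(F(x)-\int_{-\infty}^{x}f_{N,n}(t)\,\mathrm{d}t\Big)=0\qquad\text{for all }x\in\mathbb{R}.$$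
   Context: Notation: $\phi(t;\mu,\sigma)=\frac{1}{\sqrt{2\pi}\,\sigma}e^{-(t-\mu)^2/(2\sigma^2)}$ for $\mu\in\mathbb{R}$, $\sigma>0$. PDF = probability density function, CDF = cumulative distribution function. Class $\mathcal{X}$ (random variables with $L^2$-integrable tails): the class of real-valued continuous random variables $X$ with CDF $F$ such that there exist $\varepsilon>0$, $\delta>0$ and points $x_1,x_2\in\mathbb{R}$ satisfying $F(x_1)=\varepsilon$, $F(x_2)=1-\varepsilon$, $F\in L^2(-\infty,x_1+\delta)$ and $1-F\in L^2(x_2-\delta,+\infty)$. Three-segment form, with tail degree $N$, $n$ intermediate subintervals and endpoints $q_0<q_n$: $$f(t)=\begin{cases}\sum_{j=0}^N c_j^{(l)}t^j\,\phi(t;\mu^{(l)},\sigma^{(l)}), & t\le q_0,\\ P_i, & q_{i-1}\le t<q_i,\ i=1,\dots,n,\\ \sum_{j=0}^N c_j^{(r)}t^j\,\phi(t;\mu^{(r)},\sigma^{(r)}), & t\ge q_n,\end{cases}$$ where $c_j^{(l)},c_j^{(r)},\mu^{(l)},\mu^{(r)}\in\mathbb{R}$ and $\sigma^{(l)},\sigma^{(r)}>0$ are parameters, the points $q_0<q_1<\dots<q_n$ are equally spaced, $q_i-q_{i-1}=(q_n-q_0)/n$, and each $P_i$ is a real constant (piecewise constant intermediate segment). The value at the single point $t=q_0$ is given by the first line. The form by itself does not enforce non-negativity; in the convergence analysis attention is restricted to the case where $f$ is a valid probability density function. *)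

theory Defs
  imports "HOL-Probability.Probability"
begin

text \<open>Functions whose restriction to \<open>S\<close> is square integrable, and their \<open>L\<^sup>2(S)\<close>-norm. The norm
  is a Bochner integral and hence only meaningful together with membership.\<close>

definition L2_on :: "real set \<Rightarrow> (real \<Rightarrow> real) \<Rightarrow> bool" where
  "L2_on S g \<longleftrightarrow> set_borel_measurable lborel S g \<and> set_integrable lborel S (\<lambda>x. (g x)\<^sup>2)"

definition L2_norm_on :: "real set \<Rightarrow> (real \<Rightarrow> real) \<Rightarrow> real" where
  "L2_norm_on S g = sqrt (LINT x:S|lborel. (g x)\<^sup>2)"

definition rv_cdf :: "'a measure \<Rightarrow> ('a \<Rightarrow> real) \<Rightarrow> real \<Rightarrow> real" where
  "rv_cdf M X = cdf (distr M borel X)"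

text \<open>Continuity of a random variable is continuity of its distribution function; existence of a
  density is not required.\<close>

definition continuous_rv :: "'a measure \<Rightarrow> ('a \<Rightarrow> real) \<Rightarrow> bool" where
  "continuous_rv M X \<longleftrightarrow>
     prob_space M \<and> X \<in> borel_measurable M \<and> continuous_on UNIV (rv_cdf M X)"

definition L2_tails_at :: "(real \<Rightarrow> real) \<Rightarrow> real \<Rightarrow> real \<Rightarrow> bool" where
  "L2_tails_at F x1 x2 \<longleftrightarrow>
     (\<exists>\<epsilon>>0. \<exists>\<delta>>0. F x1 = \<epsilon> \<and> F x2 = 1 - \<epsilon> \<and>
        L2_on {..<x1 + \<delta>} F \<and> L2_on {x2 - \<delta><..} (\<lambda>x. 1 - F x))"

definition L2_tails_class :: "'a measure \<Rightarrow> ('a \<Rightarrow> real) set" where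
  "L2_tails_class M = {X. continuous_rv M X \<and> (\<exists>x1 x2. L2_tails_at (rv_cdf M X) x1 x2)}"

definition is_pdf :: "(real \<Rightarrow> real) \<Rightarrow> bool" where
  "is_pdf f \<longleftrightarrow> (\<forall>t. 0 \<le> f t) \<and> has_bochner_integral lborel f 1"

definition poly_normal :: "nat \<Rightarrow> (nat \<Rightarrow> real) \<Rightarrow> real \<Rightarrow> real \<Rightarrow> real \<Rightarrow> real" where
  "poly_normal N c \<mu> \<sigma> t = (\<Sum>j=0..N. c j * t ^ j * normal_density \<mu> \<sigma> t)"

definition knot :: "real \<Rightarrow> real \<Rightarrow> nat \<Rightarrow> nat \<Rightarrow> real" where
  "knot a b n i = a + real i * ((b - a) / real n)"

text \<open>\<open>a\<close> and \<open>b\<close> are the outer endpoints. The first two branches overlap at the point \<open>a\<close>, where the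
  left tail takes precedence; hence the strict \<open>a < t\<close> in the intermediate segment.\<close>

definition three_segment :: "nat \<Rightarrow> nat \<Rightarrow> real \<Rightarrow> real \<Rightarrow> (real \<Rightarrow> real) \<Rightarrow> bool" where
  "three_segment N n a b f \<longleftrightarrow> a < b \<and> 0 < n \<and>
     (\<exists>cl cr \<mu>l \<mu>r \<sigma>l \<sigma>r. \<exists>P :: nat \<Rightarrow> real. 0 < \<sigma>l \<and> 0 < \<sigma>r \<and>
        (\<forall>t\<le>a. f t = poly_normal N cl \<mu>l \<sigma>l t) \<and>
        (\<forall>i\<in>{1..n}. \<forall>t. a < t \<and> knot a b n (i - 1) \<le> t \<and> t < knot a b n i \<longrightarrow> f t = P i) \<and>
        (\<forall>t\<ge>b. f t = poly_normal N cr \<mu>r \<sigma>r t))"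

end

theory Submission
  imports Defs "HOL-Computational_Algebra.Polynomial"
begin

text \<open>
  The tail function \<open>T\<close> of \<open>F\<close> beyond an endpoint, as a function of the distance \<open>x\<close> to it, is
  approximated by the Szasz operator in the variable \<open>x\<^sup>2\<close>,
  \<open>G x = (\<Sum>j\<le>m. T (sqrt (j / r)) * (r * x\<^sup>2) ^ j / fact j * exp (- r * x\<^sup>2))\<close>.
  This is explicitly admissible: \<open>- G'\<close> is a polynomial of degree \<open>2 * m + 1\<close> times a Gaussian
  centred at the endpoint, it is nonnegative because \<open>T\<close> decreases, and \<open>G 0 = T 0\<close>, so the tail
  carries exactly the right mass. The mean and variance of the Poisson distribution give pointwise
  convergence when \<open>r\<close> and \<open>m / r\<close> tend to infinity, as well as the square integrable bound
  \<open>G x \<le> T (x / 2) + 4 * T 0 / (1 + x\<^sup>2)\<close>, so dominated convergence yields the \<open>L\<^sup>2\<close> limit.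
  On the intermediate segment the density is the step function whose distribution function agrees
  with \<open>F\<close> at the knots; both functions being monotone, they differ by at most the oscillation of
  \<open>F\<close> on a subinterval.
\<close>

section \<open>Poisson weights\<close>

definition poisson_weight :: "real \<Rightarrow> nat \<Rightarrow> real" where
  "poisson_weight \<mu> j = \<mu> ^ j / fact j * exp (- \<mu>)"

lemma poisson_weight_nonneg: "0 \<le> \<mu> \<Longrightarrow> 0 \<le> poisson_weight \<mu> j"
  by (simp add: poisson_weight_def)

lemma poisson_weight_sums: "poisson_weight \<mu> sums 1"
proof -
  have "(\<lambda>j. \<mu> ^ j / fact j) sums exp \<mu>"
    using exp_converges[of \<mu>] by (simp add: divide_inverse_commute scaleR_conv_of_real)
  from sums_mult2[OF this, of "exp (- \<mu>)"] show ?thesis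
    by (simp add: poisson_weight_def[abs_def] exp_minus)
qed

text \<open>This index shift reduces each moment of the Poisson distribution to lower ones, so the
  mean and the second moment both follow from the total mass.\<close>

lemma poisson_weight_Suc: "real (Suc j) * poisson_weight \<mu> (Suc j) = \<mu> * poisson_weight \<mu> j"
proof -
  have "fact (Suc j) = real (Suc j) * fact j" by (simp del: of_nat_Suc)
  then show ?thesis by (simp add: poisson_weight_def del: of_nat_Suc fact_Suc)
qed

lemma poisson_mean_sums: "(\<lambda>j. real j * poisson_weight \<mu> j) sums \<mu>"
proof -
  have "(\<lambda>j. real (Suc j) * poisson_weight \<mu> (Suc j)) sums (\<mu> * 1)"
    unfolding poisson_weight_Suc by (intro sums_mult poisson_weight_sums)
  from sums_Suc[OF this] show ?thesis by simp
qed

lemma poisson_second_moment_sums: "(\<lambda>j. (real j)\<^sup>2 * poisson_weight \<mu> j) sums (\<mu>\<^sup>2 + \<mu>)"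
proof -
  have eq: "(real (Suc j))\<^sup>2 * poisson_weight \<mu> (Suc j)
      = \<mu> * (real j * poisson_weight \<mu> j) + \<mu> * poisson_weight \<mu> j" for j
  proof -
    have "(real (Suc j))\<^sup>2 * poisson_weight \<mu> (Suc j)
        = real (Suc j) * (real (Suc j) * poisson_weight \<mu> (Suc j))"
      by (simp only: power2_eq_square mult.assoc)
    then show ?thesis
      by (simp only: poisson_weight_Suc) (simp add: algebra_simps)
  qed
  have "(\<lambda>j. (real (Suc j))\<^sup>2 * poisson_weight \<mu> (Suc j)) sums (\<mu> * \<mu> + \<mu> * 1)"
    unfolding eq by (intro sums_add sums_mult poisson_mean_sums poisson_weight_sums)
  from sums_Suc[OF this] show ?thesis
    by (simp add: power2_eq_square)
qed

lemma poisson_variance_sums: "(\<lambda>j. (real j - \<mu>)\<^sup>2 * poisson_weight \<mu> j) sums \<mu>"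
proof -
  have "(\<lambda>j. (real j)\<^sup>2 * poisson_weight \<mu> j - 2 * \<mu> * (real j * poisson_weight \<mu> j)
        + \<mu>\<^sup>2 * poisson_weight \<mu> j) sums ((\<mu>\<^sup>2 + \<mu>) - 2 * \<mu> * \<mu> + \<mu>\<^sup>2 * 1)"
    by (intro sums_add sums_diff sums_mult poisson_second_moment_sums poisson_mean_sums
        poisson_weight_sums)
  then show ?thesis
    by (simp add: power2_eq_square algebra_simps)
qed

text \<open>Chebyshev's argument in summed form: the quadratic majorant has Poisson expectation
  \<open>A + K * \<mu>\<close>, since the variance equals the mean. As \<open>W\<close> vanishes
  beyond \<open>m\<close>, the finite sum is already the full expectation and no truncation error
  arises.\<close>

lemma poisson_sum_le:
  assumes "0 \<le> \<mu>" and "\<And>j. W j \<le> A + K * (real j - \<mu>)\<^sup>2" and "\<And>j. m < j \<Longrightarrow> W j = 0"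
  shows "(\<Sum>j\<le>m. W j * poisson_weight \<mu> j) \<le> A + K * \<mu>"
proof (rule sums_le)
  show "(\<lambda>j. W j * poisson_weight \<mu> j) sums (\<Sum>j\<le>m. W j * poisson_weight \<mu> j)"
    by (rule sums_finite) (auto simp: assms)
  have "(\<lambda>j. A * poisson_weight \<mu> j + K * ((real j - \<mu>)\<^sup>2 * poisson_weight \<mu> j))
      sums (A * 1 + K * \<mu>)"
    by (intro sums_add sums_mult poisson_weight_sums poisson_variance_sums)
  then show "(\<lambda>j. (A + K * (real j - \<mu>)\<^sup>2) * poisson_weight \<mu> j) sums (A + K * \<mu>)"
    by (simp add: algebra_simps)
qed (intro mult_right_mono assms poisson_weight_nonneg)

text \<open>Two one-sided estimates: \<open>poisson_sum_le\<close> is applied to \<open>W\<close>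
  and to \<open>- W\<close>, with \<open>u\<close> absorbed into the constant part of the
  majorant.\<close>

lemma poisson_sum_approx:
  assumes "0 \<le> \<mu>" and W: "\<And>j. \<bar>W j - u\<bar> \<le> A + K * (real j - \<mu>)\<^sup>2"
    and 0: "\<And>j. m < j \<Longrightarrow> W j = 0"
  shows "\<bar>(\<Sum>j\<le>m. W j * poisson_weight \<mu> j) - u\<bar> \<le> A + K * \<mu>"
proof -
  have "W j \<le> (u + A) + K * (real j - \<mu>)\<^sup>2" "- W j \<le> (A - u) + K * (real j - \<mu>)\<^sup>2" for j
    using W[of j] by linarith+
  from poisson_sum_le[OF \<open>0 \<le> \<mu>\<close> this(1) 0, of m]
    poisson_sum_le[of \<mu> "\<lambda>j. - W j", OF \<open>0 \<le> \<mu>\<close> this(2), of m] 0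
  show ?thesis by (simp add: sum_negf)
qed

text \<open>For positive \<open>j\<close>, weight \<open>j\<close> has as derivative weight
  \<open>j - 1\<close> minus weight \<open>j\<close>; summation by parts moves this difference onto
  \<open>W\<close>. The boundary term with \<open>W (Suc m)\<close> is killed later by a cutoff in
  \<open>W\<close>.\<close>

lemma poisson_sum_derivative:
  "((\<lambda>\<mu>. \<Sum>j\<le>m. W j * poisson_weight \<mu> j) has_real_derivative
     - (\<Sum>j\<le>m. (W j - W (Suc j)) * poisson_weight \<mu> j) - W (Suc m) * poisson_weight \<mu> m) (at \<mu>)"
proof (induction m)
  case 0
  show ?case
    unfolding poisson_weight_def by (auto intro!: derivative_eq_intros simp: algebra_simps)
next
  case (Suc m)
  have *: "(fact (Suc m) :: real) = real (Suc m) * fact m" by (simp del: of_nat_Suc)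
  have "((\<lambda>\<mu>. poisson_weight \<mu> (Suc m)) has_real_derivative
     poisson_weight \<mu> m - poisson_weight \<mu> (Suc m)) (at \<mu>)"
    unfolding poisson_weight_def *
    by (auto intro!: derivative_eq_intros simp del: of_nat_Suc power_Suc simp: field_simps)
  from DERIV_add[OF Suc DERIV_cmult[OF this, of "W (Suc m)"]]
  show ?case by (simp add: algebra_simps)
qed

lemma poisson_weight_tendsto_0: "((\<lambda>\<mu>. poisson_weight \<mu> j) \<longlongrightarrow> 0) at_top"
proof -
  from tendsto_divide[OF tendsto_power_div_exp_0[of j] tendsto_const[of "fact j"]]
  have "((\<lambda>\<mu>. \<mu> ^ j / exp \<mu> / fact j) \<longlongrightarrow> (0::real)) at_top"
    by simp
  then show ?thesis
    by (simp add: poisson_weight_def[abs_def] exp_minus field_simps)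
qed

section \<open>Szasz approximation of a tail function\<close>

definition szasz_tail :: "nat \<Rightarrow> real \<Rightarrow> (nat \<Rightarrow> real) \<Rightarrow> real \<Rightarrow> real" where
  "szasz_tail m r W x = (\<Sum>j\<le>m. W j * poisson_weight (r * x\<^sup>2) j)"

text \<open>Minus the derivative of \<open>szasz_tail m r W\<close> when
  \<open>W (Suc m) = 0\<close>; the factor \<open>2 * r * t\<close> is the inner derivative of
  \<open>r * t\<^sup>2\<close>.\<close>

definition szasz_density :: "nat \<Rightarrow> real \<Rightarrow> (nat \<Rightarrow> real) \<Rightarrow> real \<Rightarrow> real" where
  "szasz_density m r W t =
     2 * r * t * (\<Sum>j\<le>m. (W j - W (Suc j)) * poisson_weight (r * t\<^sup>2) j)"

lemma szasz_tail_0: "szasz_tail m r W 0 = W 0"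
proof -
  have "szasz_tail m r W 0 = (\<Sum>j\<le>m. if j = 0 then W 0 else 0)"
    unfolding szasz_tail_def by (intro sum.cong) (auto simp: poisson_weight_def power_0_left)
  then show ?thesis by simp
qed

lemma szasz_density_nonneg:
  assumes "0 < r" "decseq W" "0 \<le> t"
  shows "0 \<le> szasz_density m r W t"
  unfolding szasz_density_def using assms decseqD[OF \<open>decseq W\<close>]
  by (intro mult_nonneg_nonneg sum_nonneg poisson_weight_nonneg) auto

lemma szasz_tail_derivative:
  assumes "W (Suc m) = 0"
  shows "(szasz_tail m r W has_real_derivative - szasz_density m r W x) (at x)"
proof -
  have "((\<lambda>x. r * x\<^sup>2) has_real_derivative 2 * r * x) (at x)"
    by (auto intro!: derivative_eq_intros)
  from DERIV_chain2[OF poisson_sum_derivative[of W m] this] show ?thesis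
    by (simp add: szasz_tail_def[abs_def] szasz_density_def assms mult.commute)
qed

lemma szasz_tail_tendsto_0:
  assumes "0 < r"
  shows "(szasz_tail m r W \<longlongrightarrow> 0) at_top"
proof -
  have "LIM x at_top. r * x\<^sup>2 :> at_top"
    using assms by (intro filterlim_tendsto_pos_mult_at_top[OF tendsto_const]
        filterlim_pow_at_top filterlim_ident) auto
  from filterlim_compose[OF poisson_weight_tendsto_0 this]
  have "((\<lambda>x. \<Sum>j\<le>m. W j * poisson_weight (r * x\<^sup>2) j) \<longlongrightarrow> (\<Sum>j\<le>m. W j * 0)) at_top"
    by (intro tendsto_sum tendsto_mult tendsto_const)
  then show ?thesis
    by (simp add: szasz_tail_def[abs_def])
qed

text \<open>The integrand is nonnegative on the half line, so the fundamental theorem for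
  nonnegative integrals, with antiderivative \<open>- G\<close>, yields integrability along with the
  value.\<close>

lemma has_bochner_integral_tail:
  fixes g G :: "real \<Rightarrow> real"
  assumes "g \<in> borel_measurable borel"
    and "\<And>t. x \<le> t \<Longrightarrow> (G has_real_derivative - g t) (at t)"
    and "\<And>t. x \<le> t \<Longrightarrow> 0 \<le> g t"
    and "(G \<longlongrightarrow> 0) at_top" and "0 \<le> G x"
  shows "has_bochner_integral lborel (\<lambda>t. indicator {x..} t * g t) (G x)"
proof (rule has_bochner_integral_nn_integral)
  have "(\<integral>\<^sup>+t. ennreal (g t) * indicator {x..} t \<partial>lborel) = ennreal (0 - (- G x))"
  proof (rule nn_integral_FTC_atLeast)
    show "((\<lambda>t. - G t) \<longlongrightarrow> 0) at_top"
      using tendsto_minus[OF assms(4)] by simp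
    show "((\<lambda>t. - G t) has_real_derivative g t) (at t)" if "x \<le> t" for t
      using DERIV_minus[OF assms(2)[OF that]] by simp
  qed (use assms in auto)
  then show "(\<integral>\<^sup>+t. ennreal (indicator {x..} t * g t) \<partial>lborel) = ennreal (G x)"
    by (subst nn_integral_cong[where v = "\<lambda>t. ennreal (g t) * indicator {x..} t"])
      (auto split: split_indicator)
qed (use assms in \<open>auto simp: indicator_def\<close>)

text \<open>All Poisson weights share the factor \<open>exp (- (r * t\<^sup>2))\<close>, a Gaussian
  of variance \<open>1 / (2 * r)\<close> up to normalisation. The powers of
  \<open>r * t\<^sup>2\<close> and the outer factor \<open>t\<close> leave odd monomials up to
  degree \<open>2 * m + 1\<close>.\<close>

lemma szasz_density_poly_normal:
  assumes "0 < r"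
  shows "\<exists>p \<sigma>. degree p \<le> 2 * m + 1 \<and> 0 < \<sigma> \<and>
           szasz_density m r W = (\<lambda>t. poly p t * normal_density 0 \<sigma> t)"
proof (intro exI conjI)
  define \<sigma> where "\<sigma> = 1 / sqrt (2 * r)"
  \<comment> \<open>The factor \<open>sqrt (2 * pi * \<sigma>\<^sup>2)\<close> cancels the
    normalising constant of \<open>normal_density 0 \<sigma>\<close>.\<close>
  define p where "p = (\<Sum>j\<le>m. monom (2 * r * sqrt (2 * pi * \<sigma>\<^sup>2) *
    (W j - W (Suc j)) * r ^ j / fact j) (2 * j + 1))"
  show "degree p \<le> 2 * m + 1"
    unfolding p_def by (intro degree_sum_le) (auto intro: degree_monom_le[THEN order_trans])
  show \<sigma>: "0 < \<sigma>"
    using assms by (simp add: \<sigma>_def)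
  have "exp (- (r * t\<^sup>2)) = sqrt (2 * pi * \<sigma>\<^sup>2) * normal_density 0 \<sigma> t" for t
    using \<sigma> assms by (simp add: normal_density_def \<sigma>_def power_divide)
  then show "szasz_density m r W = (\<lambda>t. poly p t * normal_density 0 \<sigma> t)"
    by (intro ext) (simp add: szasz_density_def p_def poly_sum poly_monom poisson_weight_def
        sum_distrib_left sum_distrib_right power_mult_distrib flip: power_mult,
        simp add: mult_ac)
qed

text \<open>Samples at points \<open>sqrt (j / r)\<close> beyond \<open>x / 2\<close> are at most
  \<open>T (x / 2)\<close>. The other \<open>j\<close> lie below a quarter of the Poisson mean, an
  event of probability of order \<open>1 / x\<^sup>2\<close> by Chebyshev, and there
  \<open>T 0\<close> bounds \<open>W\<close>. The bound is free of \<open>r\<close> and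
  \<open>m\<close>, so it can dominate a whole sequence of Szasz tails.\<close>

lemma szasz_tail_bounds:
  fixes T :: "real \<Rightarrow> real"
  assumes "1 \<le> r" and mono: "\<And>x y. x \<le> y \<Longrightarrow> T y \<le> T x" and nonneg: "\<And>x. 0 \<le> T x"
    and W: "\<And>j. 0 \<le> W j" "\<And>j. W j \<le> T (sqrt (real j / r))" "\<And>j. m < j \<Longrightarrow> W j = 0"
    and "0 \<le> x"
  shows "0 \<le> szasz_tail m r W x" and "szasz_tail m r W x \<le> T (x / 2) + 4 * T 0 / (1 + x\<^sup>2)"
proof -
  let ?\<mu> = "r * x\<^sup>2"
  have "0 < r" using \<open>1 \<le> r\<close> by simp
  have \<mu>: "0 \<le> ?\<mu>" using assms by simp
  show "0 \<le> szasz_tail m r W x"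
    unfolding szasz_tail_def using W(1) \<mu> by (intro sum_nonneg mult_nonneg_nonneg[OF W(1)] poisson_weight_nonneg)
  have W0: "W j \<le> T 0" for j
    using W(2)[of j] mono[of 0 "sqrt (real j / r)"] \<open>0 < r\<close> by (simp add: order_trans)
  show "szasz_tail m r W x \<le> T (x / 2) + 4 * T 0 / (1 + x\<^sup>2)"
  proof (cases "1 \<le> x")
    \<comment> \<open>Near zero the trivial bound \<open>W j \<le> T 0\<close> suffices, because
      \<open>1 + x\<^sup>2 \<le> 4\<close>.\<close>
    case False
    have "szasz_tail m r W x \<le> T 0 + 0 * ?\<mu>"
      unfolding szasz_tail_def using W W0 \<mu> by (intro poisson_sum_le) auto
    also have "\<dots> \<le> 4 * T 0 / (1 + x\<^sup>2)"
    proof -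
      have "x\<^sup>2 \<le> 1" using False \<open>0 \<le> x\<close> by (simp add: power_le_one)
      then have "(1 + x\<^sup>2) * T 0 \<le> 4 * T 0" using nonneg[of 0] by (intro mult_right_mono) auto
      then show ?thesis by (simp add: field_simps add_pos_nonneg)
    qed
    finally show ?thesis using nonneg[of "x/2"] by linarith
  next
    case True
    then have pos: "0 < ?\<mu>" using \<open>0 < r\<close> by simp
    \<comment> \<open>The coefficient \<open>16 / 9\<close> is the square of \<open>4 / 3\<close>: a
      deviation of at least \<open>3 / 4\<close> of the mean makes the quadratic term at least
      \<open>T 0\<close>.\<close>
    have "szasz_tail m r W x \<le> T (x / 2) + (T 0 * (16 / 9) / ?\<mu>\<^sup>2) * ?\<mu>"
      unfolding szasz_tail_def
    proof (rule poisson_sum_le[OF \<mu> _ W(3)])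
      fix j
      show "W j \<le> T (x / 2) + T 0 * (16 / 9) / ?\<mu>\<^sup>2 * (real j - ?\<mu>)\<^sup>2"
      proof (cases "?\<mu> / 4 \<le> real j")
        case True
        then have "(x / 2)\<^sup>2 \<le> real j / r"
          using \<open>0 < r\<close> by (simp add: field_simps)
        then have "x / 2 \<le> sqrt (real j / r)" by (rule real_le_rsqrt)
        then have "W j \<le> T (x / 2)" using W(2)[of j] mono order_trans by blast
        moreover have "0 \<le> T 0 * (16 / 9) / ?\<mu>\<^sup>2 * (real j - ?\<mu>)\<^sup>2"
          using nonneg[of 0] by simp
        ultimately show ?thesis by linarith
      next
        case False
        then have "(3 / 4 * ?\<mu>)\<^sup>2 \<le> (?\<mu> - real j)\<^sup>2"
          using pos by (intro power_mono) auto
        then have "9 / 16 * ?\<mu>\<^sup>2 \<le> (real j - ?\<mu>)\<^sup>2"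
          by (simp only: power_mult_distrib[of "3 / 4"] power2_commute[of ?\<mu>]) (simp add: power2_eq_square)
        moreover have "9 / 16 * b \<le> a \<Longrightarrow> 1 \<le> 16 / 9 / b * a" if "0 < b" for a b :: real
          using that by (simp add: field_simps)
        ultimately have "1 \<le> 16 / 9 / ?\<mu>\<^sup>2 * (real j - ?\<mu>)\<^sup>2"
          using pos by (meson zero_less_power)
        then have "T 0 * 1 \<le> T 0 * (16 / 9 / ?\<mu>\<^sup>2 * (real j - ?\<mu>)\<^sup>2)"
          using nonneg[of 0] by (intro mult_left_mono)
        then show ?thesis using W0[of j] nonneg[of "x/2"] by simp
      qed
    qed
    also have "(T 0 * (16 / 9) / ?\<mu>\<^sup>2) * ?\<mu> = T 0 * (16 / 9) / ?\<mu>"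
      using pos by (simp add: power2_eq_square)
    \<comment> \<open>Here \<open>16 / 9 \<le> 2\<close>, and \<open>1 \<le> r\<close> removes the
      dependence on \<open>r\<close>.\<close>
    also have "\<dots> \<le> T 0 * 2 / x\<^sup>2"
      using nonneg[of 0] assms True
      by (intro frac_le mult_left_mono) auto
    also have "\<dots> \<le> 4 * T 0 / (1 + x\<^sup>2)"
    proof -
      have "1 \<le> x\<^sup>2" using True by simp
      then have "2 * T 0 * (1 + x\<^sup>2) \<le> 2 * T 0 * (2 * x\<^sup>2)"
        using nonneg[of 0] by (intro mult_left_mono) auto
      then show ?thesis using True by (simp add: field_simps add_pos_nonneg)
    qed
    finally show ?thesis by simp
  qed
qed

text \<open>A constant times a Gaussian is what degree zero allows; the factor \<open>2 * c\<close>
  places mass \<open>c\<close> on the positive half line. The bound has the shape of the one for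
  Szasz tails, so that one dominating function can cover both.\<close>

lemma half_normal_tail:
  fixes c :: real
  assumes "0 \<le> c"
  defines "g \<equiv> (\<lambda>t. 2 * c * normal_density 0 (1 / sqrt 2) t)"
  obtains G where "G \<in> borel_measurable borel" and "G 0 = c"
    and "\<And>x. has_bochner_integral lborel (\<lambda>t. indicator {x..} t * g t) (G x)"
    and "\<And>x. 0 \<le> x \<Longrightarrow> 0 \<le> G x" and "\<And>x. 0 \<le> x \<Longrightarrow> G x \<le> 12 * c / (1 + x\<^sup>2)"
proof
  define G where "G = (\<lambda>x. LINT t|lborel. indicator {x..} t * g t)"
  have g: "g = (\<lambda>t. 2 * c / sqrt pi * exp (- t\<^sup>2))"
    by (rule ext) (simp add: g_def normal_density_def power_divide)
  have g_nonneg: "0 \<le> g t" for t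
    using assms by (simp add: g)
  have int: "integrable lborel g"
    unfolding g_def by (intro integrable_mult_right integrable_normal_density) auto
  show *: "has_bochner_integral lborel (\<lambda>t. indicator {x..} t * g t) (G x)" for x
    using integrable_mult_indicator[OF _ int, of "{x..}"]
    by (simp add: has_bochner_integral_iff G_def)
  show "G \<in> borel_measurable borel"
  proof -
    have integrable: "integrable lborel (\<lambda>t. indicator {x..} t * g t)" for x
      using * by (simp add: has_bochner_integral_iff)
    \<comment> \<open>Measurability of \<open>G\<close> comes from monotonicity: a nonnegative
      integrand is integrated over a shrinking half line.\<close>
    have "mono (\<lambda>x. - G x)"
      unfolding G_def
      by (intro monoI le_imp_neg_le integral_mono integrable)
        (auto simp: indicator_def g_nonneg)
    from borel_measurable_mono[OF this] show ?thesis by simp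
  qed
  have "has_bochner_integral lborel (\<lambda>t. 2 * c / sqrt pi * (indicator {0..} t *\<^sub>R exp (- t\<^sup>2)))
      (2 * c / sqrt pi * (sqrt pi / 2))"
    by (intro has_bochner_integral_mult_right gaussian_moment_0)
  moreover have "(\<lambda>t. 2 * c / sqrt pi * (indicator {0..} t *\<^sub>R exp (- t\<^sup>2)))
      = (\<lambda>t. indicator {0..} t * g t)"
    by (auto simp: g)
  ultimately show "G 0 = c"
    using has_bochner_integral_eq[OF *[of 0]] by simp
  show "0 \<le> G x" for x
    unfolding G_def by (intro integral_nonneg_AE) (simp add: g_nonneg)
  show "G x \<le> 12 * c / (1 + x\<^sup>2)" if "0 \<le> x" for x
  proof -
    have exp_tail: "has_bochner_integral lborel (\<lambda>t. indicator {x..} t * exp (- t)) (exp (- x))"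
      by (rule has_bochner_integral_tail)
        (auto intro!: derivative_eq_intros filterlim_compose[OF exp_at_bot] filterlim_uminus_at_bot_at_top)
    \<comment> \<open>Completing the square gives \<open>- t\<^sup>2 \<le> 1 - t\<close>; with
      \<open>exp 1 \<le> 3\<close> and \<open>1 \<le> sqrt pi\<close> the constant becomes
      \<open>2 * c * 3\<close>.\<close>
    have g_le: "g t \<le> 6 * c * exp (- t)" for t
    proof -
      have "- t\<^sup>2 \<le> 1 + (- t)"
        using zero_le_power2[of "t - 1 / 2"] by (simp add: power2_eq_square algebra_simps)
      then have "exp (- t\<^sup>2) \<le> exp (1 + (- t))" by simp
      also have "\<dots> \<le> 3 * exp (- t)" unfolding exp_add by (intro mult_right_mono exp_le) auto
      finally have "exp (- t\<^sup>2) \<le> 3 * exp (- t)" .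
      moreover have "2 * c / sqrt pi \<le> 2 * c / 1"
        using assms pi_gt3 by (intro divide_left_mono) auto
      ultimately have "2 * c / sqrt pi * exp (- t\<^sup>2) \<le> (2 * c / 1) * (3 * exp (- t))"
        using assms by (intro mult_mono) auto
      then show ?thesis by (simp add: g)
    qed
    have "G x \<le> 6 * c * exp (- x)"
    proof -
      have E: "has_bochner_integral lborel (\<lambda>t. 6 * c * (indicator {x..} t * exp (- t))) (6 * c * exp (- x))"
        by (intro has_bochner_integral_mult_right exp_tail)
      have "(LINT t|lborel. indicator {x..} t * g t)
          \<le> (LINT t|lborel. 6 * c * (indicator {x..} t * exp (- t)))"
        using g_le by (intro integral_mono integrable.intros[OF *[of x]] integrable.intros[OF E])
          (simp add: indicator_def)
      then show ?thesis
        unfolding has_bochner_integral_integral_eq[OF *[of x]] has_bochner_integral_integral_eq[OF E] .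
    qed
    also have "\<dots> \<le> 6 * c * (2 / (1 + x\<^sup>2))"
    proof (intro mult_left_mono)
      have "1 + x\<^sup>2 \<le> 2 * exp x"
        using exp_lower_Taylor_quadratic[OF that] that by (simp add: field_simps)
      then show "exp (- x) \<le> 2 / (1 + x\<^sup>2)"
        by (simp add: exp_minus field_simps add_pos_nonneg)
    qed (use assms in auto)
    finally show ?thesis by simp
  qed
qed

text \<open>Nodes with \<open>j / r\<close> within \<open>d\<close> of \<open>x\<^sup>2\<close>
  carry samples within \<open>e\<close> of \<open>T x\<close>; the hypothesis on \<open>m\<close>
  keeps them all below the cutoff. At every other \<open>j\<close> the deviation is at most
  \<open>T 0\<close>, while \<open>j\<close> is at least \<open>d * r\<close> away from the Poisson
  mean, so the variance \<open>r * x\<^sup>2\<close> bounds their share. Closeness is measured in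
  \<open>x\<^sup>2\<close> because the nodes are equally spaced there.\<close>

lemma szasz_tail_approx:
  fixes T :: "real \<Rightarrow> real"
  assumes "0 < r" "0 \<le> x" and mono: "\<And>x y. x \<le> y \<Longrightarrow> T y \<le> T x" and nonneg: "\<And>x. 0 \<le> T x"
    and "0 < d" and d: "\<And>y. \<lbrakk>0 \<le> y; \<bar>y - x\<^sup>2\<bar> < d\<rbrakk> \<Longrightarrow> \<bar>T (sqrt y) - T x\<bar> \<le> e" and "0 \<le> e"
    and m: "r * (x\<^sup>2 + d) \<le> real m"
  shows "\<bar>szasz_tail m r (\<lambda>j. if j \<le> m then T (sqrt (real j / r)) else 0) x - T x\<bar>
           \<le> e + T 0 * x\<^sup>2 / d\<^sup>2 / r"
proof -
  let ?W = "\<lambda>j. if j \<le> m then T (sqrt (real j / r)) else 0"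
  have W: "0 \<le> ?W j" "?W j \<le> T 0" for j
    using nonneg mono[of 0] \<open>0 < r\<close> by auto
  have "\<bar>szasz_tail m r ?W x - T x\<bar> \<le> e + T 0 / (d * r)\<^sup>2 * (r * x\<^sup>2)"
    unfolding szasz_tail_def
  proof (rule poisson_sum_approx)
    fix j
    show "\<bar>?W j - T x\<bar> \<le> e + T 0 / (d * r)\<^sup>2 * (real j - r * x\<^sup>2)\<^sup>2"
    proof (cases "\<bar>real j / r - x\<^sup>2\<bar> < d")
      case True
      then have "real j < r * (x\<^sup>2 + d)"
        using \<open>0 < r\<close> by (simp add: abs_less_iff field_simps)
      then have "?W j = T (sqrt (real j / r))" using m by simp
      then have "\<bar>?W j - T x\<bar> \<le> e" using d[of "real j / r"] True \<open>0 < r\<close> by simp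
      moreover have "0 \<le> T 0 / (d * r)\<^sup>2 * (real j - r * x\<^sup>2)\<^sup>2" using nonneg[of 0] by simp
      ultimately show ?thesis by linarith
    next
      case False
      have "d * r \<le> \<bar>real j / r - x\<^sup>2\<bar> * r" using False \<open>0 < r\<close> by simp
      also have "\<dots> = \<bar>(real j / r - x\<^sup>2) * r\<bar>" using \<open>0 < r\<close> by (simp add: abs_mult)
      also have "(real j / r - x\<^sup>2) * r = real j - r * x\<^sup>2" using \<open>0 < r\<close> by (simp add: field_simps)
      finally have "(d * r)\<^sup>2 \<le> \<bar>real j - r * x\<^sup>2\<bar>\<^sup>2"
        using \<open>0 < r\<close> \<open>0 < d\<close> by (intro power_mono) auto
      then have "1 \<le> (real j - r * x\<^sup>2)\<^sup>2 / (d * r)\<^sup>2"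
        using \<open>0 < r\<close> \<open>0 < d\<close> by (subst le_divide_eq_1_pos) auto
      then have "T 0 * 1 \<le> T 0 * ((real j - r * x\<^sup>2)\<^sup>2 / (d * r)\<^sup>2)"
        using nonneg[of 0] by (intro mult_left_mono)
      moreover have "\<bar>?W j - T x\<bar> \<le> T 0"
        using W[of j] nonneg[of x] mono[OF \<open>0 \<le> x\<close>] by linarith
      ultimately show ?thesis using \<open>0 \<le> e\<close> by simp
    qed
  qed (use assms in auto)
  also have "T 0 / (d * r)\<^sup>2 * (r * x\<^sup>2) = T 0 * x\<^sup>2 / d\<^sup>2 / r"
    using \<open>0 < r\<close> by (simp add: power2_eq_square)
  finally show ?thesis .
qed

text \<open>To be applied once to each tail of the distribution function, seen from its endpoint.
  The exact value \<open>G N 0 = T 0\<close> lets the pieces fit together to total mass one.\<close>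

lemma tail_approximation:
  fixes T :: "real \<Rightarrow> real"
  assumes mono: "\<And>x y. x \<le> y \<Longrightarrow> T y \<le> T x" and nonneg: "\<And>x. 0 \<le> T x"
    and cont: "continuous_on UNIV T" and int: "set_integrable lborel {0..} (\<lambda>x. (T x)\<^sup>2)"
  obtains g G :: "nat \<Rightarrow> real \<Rightarrow> real"
  where "\<And>N. \<exists>p \<sigma>. degree p \<le> N \<and> 0 < \<sigma> \<and> g N = (\<lambda>t. poly p t * normal_density 0 \<sigma> t)"
    and "\<And>N t. 0 \<le> t \<Longrightarrow> 0 \<le> g N t"
    and "\<And>N x. 0 \<le> x \<Longrightarrow> has_bochner_integral lborel (\<lambda>t. indicator {x..} t * g N t) (G N x)"
    and "\<And>N. G N 0 = T 0"
    and "\<And>N. set_integrable lborel {0..} (\<lambda>x. (G N x - T x)\<^sup>2)"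
    and "\<And>x. 0 \<le> x \<Longrightarrow> (\<lambda>N. G N x) \<longlonglongrightarrow> T x"
    and "(\<lambda>N. LINT x:{0..}|lborel. (G N x - T x)\<^sup>2) \<longlonglongrightarrow> 0"
proof -
  \<comment> \<open>For positive \<open>N\<close> this is the largest \<open>m\<close> with
    \<open>2 * m + 1 \<le> N\<close>.\<close>
  define m :: "nat \<Rightarrow> nat" where "m N = (N - 1) div 2" for N
  \<comment> \<open>The square root makes both \<open>r\<close> and \<open>m / r\<close> tend to
    infinity; the added 1 ensures \<open>1 \<le> r\<close>.\<close>
  define r where "r N = sqrt (1 + real (m N))" for N
  \<comment> \<open>The cutoff gives \<open>W N (Suc (m N)) = 0\<close>, which removes the boundary
    term of the derivative, and keeps \<open>W N\<close> decreasing because \<open>T\<close> is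
    nonnegative.\<close>
  define W where "W N j = (if j \<le> m N then T (sqrt (real j / r N)) else 0)" for N j
  have r1: "1 \<le> r N" for N by (simp add: r_def)
  then have r0: "0 < r N" for N using less_le_trans zero_less_one by blast
  have m_r: "real (m N) = (r N)\<^sup>2 - 1" for N by (simp add: r_def)
  have "filterlim m at_top sequentially"
    unfolding m_def filterlim_at_top
  proof (intro allI)
    show "\<forall>\<^sub>F N in sequentially. Z \<le> (N - 1) div 2" for Z
      using eventually_ge_at_top[of "2 * Z + 1"] by eventually_elim simp
  qed
  then have r_top: "filterlim r at_top sequentially"
    unfolding r_def by (intro filterlim_compose[OF sqrt_at_top]
        filterlim_tendsto_add_at_top[OF tendsto_const] filterlim_compose[OF filterlim_real_sequentially])
  have W_decseq: "decseq (W N)" for N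
    unfolding decseq_def W_def using r0[of N] nonneg
    by (auto intro!: mono real_sqrt_le_mono divide_right_mono)
  have W_bounds: "0 \<le> W N j" "W N j \<le> T (sqrt (real j / r N))" "m N < j \<Longrightarrow> W N j = 0" for N j
    using nonneg by (auto simp: W_def)
  \<comment> \<open>A common majorant of \<open>T\<close> and of all \<open>G N\<close> on the half
    line; the constant 12 is that of the half-normal tail and exceeds the 4 of the Szasz
    bound.\<close>
  define w where "w x = T (x / 2) + 12 * T 0 / (1 + x\<^sup>2)" for x
  have w_ge: "T x \<le> w x" "0 \<le> w x" if "0 \<le> x" for x
    using that mono[of "x/2" x] nonneg[of 0] nonneg[of "x/2"] by (auto simp: w_def add_increasing2)

  obtain G0 where G0: "G0 \<in> borel_measurable borel" "G0 0 = T 0"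
    "\<And>x. has_bochner_integral lborel
        (\<lambda>t. indicator {x..} t * (2 * T 0 * normal_density 0 (1 / sqrt 2) t)) (G0 x)"
    "\<And>x. 0 \<le> x \<Longrightarrow> 0 \<le> G0 x" "\<And>x. 0 \<le> x \<Longrightarrow> G0 x \<le> 12 * T 0 / (1 + x\<^sup>2)"
    by (rule half_normal_tail[OF nonneg[of 0]]) (rule that)
  \<comment> \<open>The Szasz densities have odd degree, so \<open>N = 0\<close> needs a separate half-normal tail.\<close>
  define g where "g N = (if N = 0 then (\<lambda>t. 2 * T 0 * normal_density 0 (1 / sqrt 2) t)
    else szasz_density (m N) (r N) (W N))" for N
  define G where "G N = (if N = 0 then G0 else szasz_tail (m N) (r N) (W N))" for N
  have szasz_meas: "szasz_tail (m N) (r N) (W N) \<in> borel_measurable borel"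
    "szasz_density (m N) (r N) (W N) \<in> borel_measurable borel" for N
    unfolding szasz_tail_def szasz_density_def poisson_weight_def
    by (intro borel_measurable_continuous_onI continuous_intros; simp)+
  have G_meas[measurable]: "G N \<in> borel_measurable borel" for N
    using G0(1) szasz_meas by (simp add: G_def)
  have T_meas[measurable]: "T \<in> borel_measurable borel"
    by (rule borel_measurable_continuous_onI[OF cont])
  have G_bounds: "0 \<le> G N x" "G N x \<le> w x" if "0 \<le> x" for N x
  proof -
    note b = szasz_tail_bounds[where T = T and W = "W N" and r = "r N" and m = "m N",
        OF r1 mono nonneg W_bounds that]
    have le: "4 * T 0 / (1 + x\<^sup>2) \<le> 12 * T 0 / (1 + x\<^sup>2)"
      using nonneg[of 0] by (intro divide_right_mono) auto
    show "0 \<le> G N x" using b(1) G0(4)[OF that] by (simp add: G_def)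
    show "G N x \<le> w x"
      using b(2) le G0(5)[OF that] nonneg[of "x/2"] by (simp add: G_def w_def)
  qed
  \<comment> \<open>Both \<open>G N x\<close> and \<open>T x\<close> lie between 0 and
    \<open>w x\<close>, so their distance is at most \<open>w x\<close>.\<close>
  have dom: "(G N x - T x)\<^sup>2 \<le> (w x)\<^sup>2" if "0 \<le> x" for N x
    using G_bounds[OF that, of N] w_ge[OF that] nonneg[of x] by (intro power2_le_iff_abs_le[THEN iffD2]) auto
  have w_int: "integrable lborel (\<lambda>x. indicator {0..} x * (w x)\<^sup>2)"
  proof (rule Bochner_Integration.integrable_bound)
    have "integrable lborel (\<lambda>x. indicator {0..} x *\<^sub>R (T x)\<^sup>2)"
      using int by (simp add: set_integrable_def)
    \<comment> \<open>The substitution \<open>x / 2\<close> for \<open>x\<close> transfers square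
      integrability from \<open>T\<close> to the dilated function.\<close>
    then have "integrable lborel (\<lambda>x. indicator {0..} (0 + 1 / 2 * x) *\<^sub>R (T (0 + 1 / 2 * x))\<^sup>2)"
      by (subst (asm) lborel_integrable_real_affine_iff[where c = "1 / 2" and t = 0, symmetric]) auto
    moreover have "indicator {0..} (0 + 1 / 2 * x) = (indicator {0..} x :: real)" for x :: real
      by (auto simp: indicator_def)
    ultimately have 1: "integrable lborel (\<lambda>x. indicator {0..} x * (T (x / 2))\<^sup>2)" by simp
    have 2: "integrable lborel (\<lambda>x::real. inverse (1 + x\<^sup>2))"
      using integrable_inverse_1_plus_square by (simp add: set_integrable_def einterval_def)
    \<comment> \<open>From \<open>(a + b)\<^sup>2 \<le> 2 * a\<^sup>2 + 2 * b\<^sup>2\<close>: the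
      constant 288 is twice the square of 12, and one factor \<open>1 / (1 + x\<^sup>2)\<close> is
      estimated by 1.\<close>
    show "integrable lborel (\<lambda>x. 2 * (indicator {0..} x * (T (x / 2))\<^sup>2)
        + 288 * (T 0)\<^sup>2 * inverse (1 + x\<^sup>2))"
      using 1 2 by (intro Bochner_Integration.integrable_add integrable_mult_right)
    show "(\<lambda>x. indicator {0..} x * (w x)\<^sup>2) \<in> borel_measurable lborel"
      unfolding w_def by measurable
    show "AE x in lborel. norm (indicator {0..} x * (w x)\<^sup>2)
        \<le> norm (2 * (indicator {0..} x * (T (x / 2))\<^sup>2) + 288 * (T 0)\<^sup>2 * inverse (1 + x\<^sup>2))"
    proof (intro AE_I2)
      fix x :: real
      have sq: "(a + b)\<^sup>2 \<le> 2 * a\<^sup>2 + 2 * b\<^sup>2" for a b :: real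
        using zero_le_power2[of "a - b"] by (simp add: power2_eq_square algebra_simps)
      have "(12 * T 0 / (1 + x\<^sup>2))\<^sup>2 = 144 * (T 0)\<^sup>2 * ((1 / (1 + x\<^sup>2)) * (1 / (1 + x\<^sup>2)))"
        by (simp add: power2_eq_square)
      also have "\<dots> \<le> 144 * (T 0)\<^sup>2 * ((1 / (1 + x\<^sup>2)) * 1)"
        by (intro mult_left_mono) (auto simp: field_simps add_pos_nonneg)
      finally have "(w x)\<^sup>2 \<le> 2 * (T (x / 2))\<^sup>2 + 288 * (T 0)\<^sup>2 * inverse (1 + x\<^sup>2)"
        using sq[of "T (x / 2)" "12 * T 0 / (1 + x\<^sup>2)"]
        unfolding w_def inverse_eq_divide mult_1_right by linarith
      moreover have "0 \<le> 288 * (T 0)\<^sup>2 * inverse (1 + x\<^sup>2)" by simp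
      ultimately show "norm (indicator {0..} x * (w x)\<^sup>2)
        \<le> norm (2 * (indicator {0..} x * (T (x / 2))\<^sup>2) + 288 * (T 0)\<^sup>2 * inverse (1 + x\<^sup>2))"
        by (auto simp: indicator_def)
    qed
  qed
  have lim: "(\<lambda>N. G N x) \<longlonglongrightarrow> T x" if "0 \<le> x" for x
  proof (rule tendstoI)
    fix e :: real assume "0 < e"
    have "continuous_on {0..} (\<lambda>y. T (sqrt y))"
      by (intro continuous_on_compose2[OF cont] continuous_intros) auto
    note this[unfolded continuous_on_iff, rule_format, of "x\<^sup>2" "e / 2"]
    then obtain d where "0 < d" and
      d: "\<And>y. \<lbrakk>0 \<le> y; \<bar>y - x\<^sup>2\<bar> < d\<rbrakk> \<Longrightarrow> \<bar>T (sqrt y) - T x\<bar> < e / 2"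
      using \<open>0 \<le> x\<close> \<open>0 < e\<close> by (auto simp: dist_real_def)
    have "((\<lambda>N. T 0 * x\<^sup>2 / d\<^sup>2 / r N) \<longlongrightarrow> 0) sequentially"
      by (intro real_tendsto_divide_at_top[OF tendsto_const r_top])
    then have "\<forall>\<^sub>F N in sequentially. T 0 * x\<^sup>2 / d\<^sup>2 / r N < e / 2"
      using \<open>0 < e\<close> by (intro order_tendstoD) auto
    moreover have "\<forall>\<^sub>F N in sequentially. x\<^sup>2 + d + 1 \<le> r N"
      using r_top by (simp add: filterlim_at_top)
    ultimately show "\<forall>\<^sub>F N in sequentially. dist (G N x) (T x) < e"
      using eventually_gt_at_top[of 0]
    proof eventually_elim
      case (elim N)
      \<comment> \<open>The cutoff condition of \<open>szasz_tail_approx\<close>: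
        \<open>r\<^sup>2 - r \<le> r\<^sup>2 - 1\<close>, and the right-hand side is
        \<open>m N\<close>.\<close>
      have "r N * (x\<^sup>2 + d) \<le> r N * (r N - 1)"
        using elim r0[of N] by (intro mult_left_mono) auto
      also have "\<dots> \<le> real (m N)" using r1[of N] by (simp add: m_r power2_eq_square algebra_simps)
      finally have "\<bar>szasz_tail (m N) (r N) (W N) x - T x\<bar> \<le> e / 2 + T 0 * x\<^sup>2 / d\<^sup>2 / r N"
        unfolding W_def using \<open>0 < e\<close> r0[of N]
        by (intro szasz_tail_approx[OF _ that mono nonneg \<open>0 < d\<close>] less_imp_le[OF d]) auto
      then have "\<bar>szasz_tail (m N) (r N) (W N) x - T x\<bar> < e" using elim by linarith
      then show ?case using elim by (simp add: G_def dist_real_def)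
    qed
  qed
  have diff_meas: "(\<lambda>x. indicator {0..} x * (G N x - T x)\<^sup>2) \<in> borel_measurable lborel" for N
    by measurable
  have dom': "AE x in lborel. norm (indicator {0..} x * (G N x - T x)\<^sup>2) \<le> indicator {0..} x * (w x)\<^sup>2" for N
    using dom by (intro AE_I2) (auto simp: indicator_def)
  show thesis
  proof
    show "\<exists>p \<sigma>. degree p \<le> N \<and> 0 < \<sigma> \<and> g N = (\<lambda>t. poly p t * normal_density 0 \<sigma> t)" for N
    proof (cases "N = 0")
      case True
      then show ?thesis
        by (intro exI[of _ "[:2 * T 0:]"] exI[of _ "1 / sqrt 2"]) (simp add: g_def)
    next
      case False
      then have "2 * m N + 1 \<le> N" by (simp add: m_def)
      then show ?thesis
        using szasz_density_poly_normal[OF r0, of "m N" N "W N"] False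
        by (fastforce simp: g_def intro: order_trans)
    qed
    show "0 \<le> g N t" if "0 \<le> t" for N t
      using szasz_density_nonneg[OF r0 W_decseq that] nonneg[of 0] by (simp add: g_def)
    show "has_bochner_integral lborel (\<lambda>t. indicator {x..} t * g N t) (G N x)" if "0 \<le> x" for N x
    proof (cases "N = 0")
      case False
      have "has_bochner_integral lborel (\<lambda>t. indicator {x..} t * szasz_density (m N) (r N) (W N) t)
          (szasz_tail (m N) (r N) (W N) x)"
        by (intro has_bochner_integral_tail szasz_tail_derivative szasz_tail_tendsto_0 r0
            szasz_meas szasz_density_nonneg W_decseq)
          (use that G_bounds(1)[OF that, of N] False W_bounds(3)[of N] in \<open>auto simp: G_def\<close>)
      then show ?thesis using False by (simp add: g_def G_def)
    qed (simp add: g_def G_def G0(3))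
    show "G N 0 = T 0" for N
      by (simp add: G_def G0(2) szasz_tail_0 W_def)
    show "set_integrable lborel {0..} (\<lambda>x. (G N x - T x)\<^sup>2)" for N
      unfolding set_integrable_def real_scaleR_def
      using diff_meas dom' by (intro Bochner_Integration.integrable_bound[OF w_int])
        (auto elim!: eventually_mono)
    show "(\<lambda>N. LINT x:{0..}|lborel. (G N x - T x)\<^sup>2) \<longlonglongrightarrow> 0"
    proof -
      have "(\<lambda>N. LINT x|lborel. indicator {0..} x * (G N x - T x)\<^sup>2) \<longlonglongrightarrow> (LINT x::real|lborel. (0::real))"
      proof (rule integral_dominated_convergence[where f = "\<lambda>_. 0"
            and s = "\<lambda>N x. indicator {0..} x * (G N x - T x)\<^sup>2" and w = "\<lambda>x. indicator {0..} x * (w x)\<^sup>2"])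
        show "AE x in lborel. (\<lambda>N. indicator {0..} x * (G N x - T x)\<^sup>2) \<longlonglongrightarrow> 0"
        proof (intro AE_I2)
          fix x :: real
          have "(\<lambda>N. (G N x - T x)\<^sup>2) \<longlonglongrightarrow> (T x - T x)\<^sup>2" if "0 \<le> x"
            by (intro tendsto_intros lim that)
          then show "(\<lambda>N. indicator {0..} x * (G N x - T x)\<^sup>2) \<longlonglongrightarrow> 0"
            by (auto simp: indicator_def)
        qed
      qed (use w_int dom' in auto)
      then show ?thesis by (simp add: set_lebesgue_integral_def)
    qed
  qed (fact lim)
qed

section \<open>The intermediate segment\<close>

lemma knot_le: "a < b \<Longrightarrow> i \<le> j \<Longrightarrow> knot a b n i \<le> knot a b n j"
  unfolding knot_def by (intro add_left_mono mult_right_mono) auto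

lemma knot_cover:
  assumes "a \<le> x" "x \<le> b" "a < b" "0 < n"
  obtains i where "i < n" "knot a b n i \<le> x" "x \<le> knot a b n (Suc i)"
proof -
  define h where "h = (b - a) / real n"
  have h: "0 < h" "real n * h = b - a" using assms by (simp_all add: h_def)
  show thesis
  proof (cases "x = b")
    \<comment> \<open>At the right endpoint the floor used below would give the index
      \<open>n\<close>, so the last subinterval is named directly.\<close>
    case True
    have "real (n - 1) * h \<le> real n * h" using h by (intro mult_right_mono) auto
    with True show thesis using assms h
      by (intro that[of "n - 1"]) (auto simp: knot_def simp flip: h_def)
  next
    case False
    define i where "i = nat \<lfloor>(x - a) / h\<rfloor>"
    have "0 \<le> (x - a) / h" using assms h by simp
    then have i: "real i \<le> (x - a) / h" "(x - a) / h < real i + 1" unfolding i_def by linarith+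
    then have "real i * h \<le> x - a" "x - a < (real i + 1) * h" using h by (simp_all add: field_simps)
    moreover have "(x - a) / h < real n" using h False assms by (simp add: field_simps)
    then have "i < n" using i by linarith
    ultimately show thesis
      by (intro that[of i]) (auto simp: knot_def algebra_simps simp flip: h_def)
  qed
qed

text \<open>The height on each subinterval is the increment of \<open>F\<close> divided by the
  width, so the integral up to a knot telescopes.\<close>

lemma step_density:
  fixes F :: "real \<Rightarrow> real"
  assumes "a < b" "0 < n" "mono F"
  obtains mid P
  where "\<And>t. 0 \<le> mid t" and "\<And>t. t \<le> a \<or> b \<le> t \<Longrightarrow> mid t = 0"
    and "\<And>i t. \<lbrakk>i \<in> {1..n}; a < t; knot a b n (i - 1) \<le> t; t < knot a b n i\<rbrakk> \<Longrightarrow> mid t = P i"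
    and "\<And>m. m \<le> n \<Longrightarrow> has_bochner_integral lborel
           (\<lambda>t. indicator {..knot a b n m} t * mid t) (F (knot a b n m) - F a)"
proof
  define k where "k = knot a b n"
  define h where "h = (b - a) / real n"
  have h: "0 < h" using assms by (simp add: h_def)
  have k0: "k 0 = a" and kn: "k n = b" using assms by (simp_all add: k_def knot_def)
  have k_le: "i \<le> j \<Longrightarrow> k i \<le> k j" for i j using assms unfolding k_def by (intro knot_le)
  have k_step: "k i - k (i - 1) = h" if "1 \<le> i" for i
    using that by (simp add: k_def knot_def h_def algebra_simps of_nat_diff diff_divide_distrib)
  define P where "P i = (F (k i) - F (k (i - 1))) / h" for i
  \<comment> \<open>The point \<open>a\<close> is removed because the left tail determines the value
    of the density there.\<close>
  define S where "S i = {k (i - 1)..<k i} - {a}" for i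
  define mid where "mid t = (\<Sum>i=1..n. P i * indicator (S i) t)" for t
  have P: "0 \<le> P i" for i
    using h monoD[OF \<open>mono F\<close> k_le[of "i - 1" i]] by (simp add: P_def)
  then show "0 \<le> mid t" for t
    unfolding mid_def by (intro sum_nonneg mult_nonneg_nonneg) auto
  have disj: "t \<notin> S j" if "t \<in> S i" "i \<noteq> j" for i j t
  proof (cases "i < j")
    case True
    then have "k i \<le> k (j - 1)" by (intro k_le) simp
    then show ?thesis using that by (auto simp: S_def)
  next
    case False
    then have "k j \<le> k (i - 1)" using that by (intro k_le) simp
    then show ?thesis using that by (auto simp: S_def)
  qed
  show "mid t = P i" if "i \<in> {1..n}" "a < t" "knot a b n (i - 1) \<le> t" "t < knot a b n i" for i t
  proof -
    have "t \<in> S i" using that by (simp add: S_def k_def)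
    then have "mid t = (\<Sum>j=1..n. if j = i then P i else 0)"
      unfolding mid_def by (intro sum.cong) (auto simp: disj)
    then show ?thesis using that by simp
  qed
  have S_sub: "a < t \<and> t < k i" if "t \<in> S i" for t i
    using that k_le[of 0 "i - 1"] k0 by (auto simp: S_def)
  show "mid t = 0" if "t \<le> a \<or> b \<le> t" for t
    unfolding mid_def
  proof (intro sum.neutral ballI)
    fix i assume "i \<in> {1..n}"
    then have "t \<notin> S i" using S_sub[of t i] k_le[of i n] kn that by auto
    then show "P i * indicator (S i) t = 0" by simp
  qed
  show "has_bochner_integral lborel (\<lambda>t. indicator {..knot a b n m} t * mid t)
      (F (knot a b n m) - F a)" if "m \<le> n" for m
  proof -
    have S_int: "has_bochner_integral lborel (\<lambda>t. P i * indicator (S i) t) (F (k i) - F (k (i - 1)))"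
      if "i \<in> {1..m}" for i
    proof -
      have "emeasure lborel (S i) = ennreal h"
        unfolding S_def using that k_step[of i] k_le[of "i - 1" i]
        by (subst emeasure_Diff_null_set) auto
      then have "has_bochner_integral lborel (indicator (S i)) h"
        using has_bochner_integral_real_indicator[of "S i" lborel] h by (simp add: measure_def S_def)
      then have "has_bochner_integral lborel (\<lambda>t. P i * indicator (S i) t) (P i * h)"
        by (intro has_bochner_integral_mult_right)
      then show ?thesis using h by (simp add: P_def)
    qed
    have "has_bochner_integral lborel (\<lambda>t. \<Sum>i=1..m. P i * indicator (S i) t)
        (\<Sum>i=1..m. F (k i) - F (k (i - 1)))"
      by (intro has_bochner_integral_sum S_int)
    also have "(\<Sum>i=1..m. F (k i) - F (k (i - 1))) = F (k m) - F (k 0)"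
      by (induction m) auto
    also have "has_bochner_integral lborel (\<lambda>t. \<Sum>i=1..m. P i * indicator (S i) t) (F (k m) - F (k 0))
        \<longleftrightarrow> has_bochner_integral lborel (\<lambda>t. indicator {..k m} t * mid t) (F (k m) - F (k 0))"
    proof (rule has_bochner_integral_cong_AE)
      \<comment> \<open>Equality can fail at \<open>k m\<close> itself: it belongs to
        \<open>{..k m}\<close>, but \<open>mid\<close> takes the height of the following subinterval
        there.\<close>
      show "AE t in lborel. (\<Sum>i=1..m. P i * indicator (S i) t) = indicator {..k m} t * mid t"
        using AE_lborel_singleton[of "k m"]
      proof eventually_elim
        case (elim t)
        have mid_split: "mid t = (\<Sum>i=1..m. P i * indicator (S i) t) + (\<Sum>i=m+1..n. P i * indicator (S i) t)"
          using sum.ub_add_nat[of 1 m "\<lambda>i. P i * indicator (S i) t" "n - m"] \<open>m \<le> n\<close>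
          by (simp add: mid_def)
        show ?case
        proof (cases "t < k m")
          case True
          have "(\<Sum>i=m+1..n. P i * indicator (S i) t) = 0"
          proof (intro sum.neutral ballI)
            fix i assume "i \<in> {m+1..n}"
            then have "k m \<le> k (i - 1)" by (intro k_le) auto
            then have "t \<notin> S i" using True by (auto simp: S_def)
            then show "P i * indicator (S i) t = 0" by simp
          qed
          with True mid_split show ?thesis by simp
        next
          case False
          have "(\<Sum>i=1..m. P i * indicator (S i) t) = 0"
          proof (intro sum.neutral ballI)
            fix i assume "i \<in> {1..m}"
            then have "t \<notin> S i" using False S_sub[of t i] k_le[of i m] by auto
            then show "P i * indicator (S i) t = 0" by simp
          qed
          with False elim show ?thesis by simp
        qed
      qed
      show "(\<lambda>t. indicator {..k m} t * mid t) \<in> borel_measurable lborel"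
        unfolding mid_def S_def by measurable
      show "(\<lambda>t. \<Sum>i=1..m. P i * indicator (S i) t) \<in> borel_measurable lborel"
        unfolding S_def by measurable
    qed
    finally show ?thesis by (simp add: k_def[symmetric] k0)
  qed
qed

section \<open>Polynomial multiples of Gaussians under reflection and translation\<close>

lemma poly_normal_poly:
  assumes "degree p \<le> N"
  shows "poly_normal N (coeff p) \<mu> \<sigma> t = poly p t * normal_density \<mu> \<sigma> t"
proof -
  have "poly p t = (\<Sum>j\<le>N. coeff p j * t ^ j)"
    using assms by (subst poly_as_sum_of_monoms'[OF assms, symmetric]) (simp add: poly_sum poly_monom)
  then show ?thesis
    by (simp add: poly_normal_def sum_distrib_right atLeast0AtMost)
qed

text \<open>Composition with an affine map does not raise the degree, and the centred Gaussian is
  even. The sign \<open>s = - 1\<close> serves the left tail and \<open>s = 1\<close> the right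
  one.\<close>

lemma poly_normal_affine:
  assumes "degree p \<le> N" and "\<bar>s\<bar> = 1"
  shows "\<exists>c. \<forall>t. poly p (s * (t - a)) * normal_density 0 \<sigma> (s * (t - a)) = poly_normal N c a \<sigma> t"
proof (intro exI allI)
  fix t
  let ?q = "pcompose p [:- s * a, s:]"
  have "degree ?q \<le> degree p * 1"
    using degree_pcompose_le[of p "[:- s * a, s:]"] by (auto elim: order_trans)
  then have "poly_normal N (coeff ?q) a \<sigma> t = poly ?q t * normal_density a \<sigma> t"
    using assms(1) by (intro poly_normal_poly) simp
  moreover have "(s * (t - a))\<^sup>2 = (t - a)\<^sup>2"
    using assms(2) by (simp add: power_mult_distrib flip: power2_abs[of s])
  ultimately show "poly p (s * (t - a)) * normal_density 0 \<sigma> (s * (t - a))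
      = poly_normal N (coeff ?q) a \<sigma> t"
    by (simp add: poly_pcompose normal_density_def algebra_simps)
qed

section \<open>Assembling the density\<close>

text \<open>The masses \<open>F a\<close>, \<open>F b - F a\<close> and \<open>1 - F b\<close> add
  up to one. Monotonicity and the values at the knots are recorded because they control the
  distribution function between knots.\<close>

lemma three_segment_assembly:
  fixes F gl gr Gl Gr :: "real \<Rightarrow> real"
  assumes "a < b" "0 < n" "mono F"
    and gl: "\<exists>p \<sigma>. degree p \<le> N \<and> 0 < \<sigma> \<and> gl = (\<lambda>t. poly p t * normal_density 0 \<sigma> t)"
      "\<And>t. 0 \<le> t \<Longrightarrow> 0 \<le> gl t"
      "\<And>x. 0 \<le> x \<Longrightarrow> has_bochner_integral lborel (\<lambda>t. indicator {x..} t * gl t) (Gl x)"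
      "Gl 0 = F a"
    and gr: "\<exists>p \<sigma>. degree p \<le> N \<and> 0 < \<sigma> \<and> gr = (\<lambda>t. poly p t * normal_density 0 \<sigma> t)"
      "\<And>t. 0 \<le> t \<Longrightarrow> 0 \<le> gr t"
      "\<And>x. 0 \<le> x \<Longrightarrow> has_bochner_integral lborel (\<lambda>t. indicator {x..} t * gr t) (Gr x)"
      "Gr 0 = 1 - F b"
  obtains f where "is_pdf f" and "three_segment N n a b f"
    and "mono (\<lambda>x. LINT t:{..x}|lborel. f t)"
    and "\<And>x. x \<le> a \<Longrightarrow> (LINT t:{..x}|lborel. f t) = Gl (a - x)"
    and "\<And>x. b \<le> x \<Longrightarrow> (LINT t:{..x}|lborel. f t) = 1 - Gr (x - b)"
    and "\<And>i. i \<le> n \<Longrightarrow> (LINT t:{..knot a b n i}|lborel. f t) = F (knot a b n i)"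
proof -
  have k_ends: "knot a b n 0 = a" "knot a b n n = b"
    using assms(1,2) by (simp_all add: knot_def)
  obtain mid P where mid: "\<And>t. 0 \<le> mid t" "\<And>t. t \<le> a \<or> b \<le> t \<Longrightarrow> mid t = 0"
    "\<And>i t. \<lbrakk>i \<in> {1..n}; a < t; knot a b n (i - 1) \<le> t; t < knot a b n i\<rbrakk> \<Longrightarrow> mid t = P i"
    "\<And>m. m \<le> n \<Longrightarrow> has_bochner_integral lborel
       (\<lambda>t. indicator {..knot a b n m} t * mid t) (F (knot a b n m) - F a)"
    by (rule step_density[OF assms(1-3)]) (rule that)
  \<comment> \<open>The summands never overlap: \<open>mid\<close> vanishes up to \<open>a\<close>
    and from \<open>b\<close> on, matching the precedence of the tails at both endpoints.\<close>
  define f where "f t = indicator {..a} t * gl (a - t) + mid t + indicator {b..} t * gr (t - b)" for t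
  define H where "H x = (LINT t:{..x}|lborel. f t)" for x
  have left: "has_bochner_integral lborel (\<lambda>t. indicator {..x} t * gl (a - t)) (Gl (a - x))"
    if "x \<le> a" for x
  proof -
    have "has_bochner_integral lborel (\<lambda>t. indicator {a - x..} (a + - 1 * t) * gl (a + - 1 * t))
        (Gl (a - x) /\<^sub>R \<bar>- 1\<bar>)"
      using gl(3)[of "a - x"] that
      by (subst lborel_has_bochner_integral_real_affine_iff[symmetric]) auto
    moreover have "indicator {a - x..} (a + - 1 * t) = (indicator {..x} t :: real)" for t
      by (auto simp: indicator_def)
    ultimately show ?thesis by simp
  qed
  have right: "has_bochner_integral lborel (\<lambda>t. indicator {x..} t * gr (t - b)) (Gr (x - b))"
    if "b \<le> x" for x
  proof -
    have "has_bochner_integral lborel (\<lambda>t. indicator {x - b..} (- b + 1 * t) * gr (- b + 1 * t))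
        (Gr (x - b) /\<^sub>R \<bar>1\<bar>)"
      using gr(3)[of "x - b"] that
      by (subst lborel_has_bochner_integral_real_affine_iff[symmetric]) auto
    moreover have "indicator {x - b..} (- b + 1 * t) = (indicator {x..} t :: real)" for t
      by (auto simp: indicator_def)
    ultimately show ?thesis by simp
  qed
  have mid_total: "has_bochner_integral lborel mid (F b - F a)"
  proof -
    have "(\<lambda>t. indicator {..b} t * mid t) = mid"
      using mid(2) by (intro ext) (auto simp: indicator_def)
    with mid(4)[of n] show ?thesis by (simp add: k_ends)
  qed
  have f_nonneg: "0 \<le> f t" for t
    unfolding f_def using gl(2) gr(2) mid(1) by (auto simp: indicator_def)
  have "has_bochner_integral lborel f (Gl (a - a) + (F b - F a) + Gr (b - b))"
    unfolding f_def by (intro has_bochner_integral_add left right mid_total order_refl)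
  then have total: "has_bochner_integral lborel f 1"
    by (simp add: gl(4) gr(4))
  note [measurable] = borel_measurable_has_bochner_integral[OF total]
  \<comment> \<open>Almost everywhere equality is enough, so single points where indicators overlap
    may be discarded in the uses below.\<close>
  have H_eq: "H x = y"
    if "has_bochner_integral lborel g y" "AE t in lborel. g t = indicator {..x} t * f t" for g x y
  proof -
    have [measurable]: "g \<in> borel_measurable lborel"
      by (rule borel_measurable_has_bochner_integral[OF that(1)])
    have "has_bochner_integral lborel (\<lambda>t. indicator {..x} t * f t) y"
      using that by (subst has_bochner_integral_cong_AE[where g = g]) (auto elim: eventually_mono)
    then show ?thesis
      by (simp add: H_def set_lebesgue_integral_def has_bochner_integral_integral_eq)
  qed
  have "is_pdf f"
    using f_nonneg total by (simp add: is_pdf_def)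
  moreover have "three_segment N n a b f"
  proof -
    obtain pl \<sigma>l where pl: "degree pl \<le> N" "0 < \<sigma>l" "gl = (\<lambda>t. poly pl t * normal_density 0 \<sigma>l t)"
      using gl(1) by blast
    obtain pr \<sigma>r where pr: "degree pr \<le> N" "0 < \<sigma>r" "gr = (\<lambda>t. poly pr t * normal_density 0 \<sigma>r t)"
      using gr(1) by blast
    obtain cl where cl: "\<And>t. gl (a - t) = poly_normal N cl a \<sigma>l t"
      using poly_normal_affine[OF pl(1), of "- 1" a \<sigma>l] by (auto simp: pl(3))
    obtain cr where cr: "\<And>t. gr (t - b) = poly_normal N cr b \<sigma>r t"
      using poly_normal_affine[OF pr(1), of 1 b \<sigma>r] by (auto simp: pr(3))
    have "f t = poly_normal N cl a \<sigma>l t" if "t \<le> a" for t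
      using that \<open>a < b\<close> by (simp add: f_def mid(2) cl)
    moreover have "f t = poly_normal N cr b \<sigma>r t" if "b \<le> t" for t
      using that \<open>a < b\<close> by (simp add: f_def mid(2) cr)
    moreover have "f t = P i"
      if "i \<in> {1..n}" "a < t" "knot a b n (i - 1) \<le> t" "t < knot a b n i" for i t
    proof -
      have "t < b" using that knot_le[OF \<open>a < b\<close>, of i n n] k_ends by auto
      then show ?thesis using mid(3)[OF that] that by (simp add: f_def)
    qed
    ultimately show ?thesis
      unfolding three_segment_def using \<open>a < b\<close> \<open>0 < n\<close> pl(2) pr(2) by blast
  qed
  moreover have "mono H"
    unfolding H_def set_lebesgue_integral_def real_scaleR_def
  proof (intro monoI integral_mono)
    show "integrable lborel (\<lambda>t. indicator {..x} t * f t)" for x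
      using integrable_mult_indicator[OF _ integrable.intros[OF total], of "{..x}"] by simp
    then show "integrable lborel (\<lambda>t. indicator {..x} t * f t)" for x .
  qed (auto simp: indicator_def f_nonneg)
  moreover have "H x = Gl (a - x)" if "x \<le> a" for x
    using that \<open>a < b\<close> by (intro H_eq[OF left]) (auto simp: f_def indicator_def mid(2))
  moreover have "H x = 1 - Gr (x - b)" if "b \<le> x" for x
  proof (rule H_eq)
    \<comment> \<open>To the right of \<open>b\<close> the integral is the total mass minus the
      remaining right tail.\<close>
    show "has_bochner_integral lborel (\<lambda>t. f t - indicator {x..} t * gr (t - b)) (1 - Gr (x - b))"
      by (intro has_bochner_integral_diff total right that)
    show "AE t in lborel. f t - indicator {x..} t * gr (t - b) = indicator {..x} t * f t"
      using AE_lborel_singleton[of x]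
      by eventually_elim (use that \<open>a < b\<close> in \<open>auto simp: f_def indicator_def mid(2)\<close>)
  qed
  moreover have "H (knot a b n i) = F (knot a b n i)" if "i \<le> n" for i
  proof (rule H_eq)
    have k: "a \<le> knot a b n i" "knot a b n i \<le> b"
      using knot_le[OF \<open>a < b\<close>, of 0 i n] knot_le[OF \<open>a < b\<close>, of i n n] that k_ends by auto
    have "has_bochner_integral lborel
        (\<lambda>t. indicator {..a} t * gl (a - t) + indicator {..knot a b n i} t * mid t)
        (Gl (a - a) + (F (knot a b n i) - F a))"
      by (intro has_bochner_integral_add left mid(4) that order_refl)
    then show "has_bochner_integral lborel
        (\<lambda>t. indicator {..a} t * gl (a - t) + indicator {..knot a b n i} t * mid t) (F (knot a b n i))"
      by (simp add: gl(4))
    show "AE t in lborel. indicator {..a} t * gl (a - t) + indicator {..knot a b n i} t * mid t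
        = indicator {..knot a b n i} t * f t"
      \<comment> \<open>For the last knot the half line includes \<open>b\<close>, where
        \<open>f\<close> already takes the value of the right tail.\<close>
      using AE_lborel_singleton[of b]
      by eventually_elim (use k in \<open>auto simp: f_def indicator_def\<close>)
  qed
  ultimately show thesis
    unfolding H_def by (rule that)
qed

text \<open>The modulus of continuity at the knot spacing, which tends to 0 by uniform continuity on
  a compact interval; boundedness of \<open>F\<close> there makes the supremum finite.\<close>

lemma uniform_oscillation:
  fixes F :: "real \<Rightarrow> real"
  assumes "a < b" and cont: "continuous_on {a..b} F"
  obtains \<omega> :: "nat \<Rightarrow> real" where "\<omega> \<longlonglongrightarrow> 0"
    and "\<And>n x y. \<lbrakk>x \<in> {a..b}; y \<in> {a..b}; \<bar>x - y\<bar> \<le> (b - a) / real n\<rbrakk> \<Longrightarrow> \<bar>F x - F y\<bar> \<le> \<omega> n"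
proof
  define A where "A n = {\<bar>F x - F y\<bar> | x y. x \<in> {a..b} \<and> y \<in> {a..b} \<and> \<bar>x - y\<bar> \<le> (b - a) / real n}" for n
  have "bounded (F ` {a..b})"
    by (intro compact_imp_bounded compact_continuous_image cont) simp
  then obtain B where B: "\<And>x. x \<in> {a..b} \<Longrightarrow> \<bar>F x\<bar> \<le> B"
    by (auto simp: bounded_iff simp del: atLeastAtMost_iff)
  have bdd: "bdd_above (A n)" for n
  proof (rule bdd_aboveI)
    fix z assume "z \<in> A n"
    then obtain x y where "z = \<bar>F x - F y\<bar>" "x \<in> {a..b}" "y \<in> {a..b}" by (auto simp: A_def)
    with B[of x] B[of y] show "z \<le> 2 * B" by linarith
  qed
  have A0: "0 \<in> A n" for n
    using \<open>a < b\<close> by (force simp: A_def intro!: exI[of _ a])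
  show "\<bar>F x - F y\<bar> \<le> Sup (A n)"
    if "x \<in> {a..b}" "y \<in> {a..b}" "\<bar>x - y\<bar> \<le> (b - a) / real n" for n x y
    using that by (intro cSup_upper bdd) (auto simp: A_def)
  show "(\<lambda>n. Sup (A n)) \<longlonglongrightarrow> 0"
  proof (rule tendstoI)
    fix e :: real assume "0 < e"
    have "uniformly_continuous_on {a..b} F"
      by (intro compact_uniformly_continuous cont) simp
    from this[unfolded uniformly_continuous_on_def, rule_format, of "e / 2"] \<open>0 < e\<close>
    obtain d where d: "0 < d"
      "\<And>x y. \<lbrakk>x \<in> {a..b}; y \<in> {a..b}; \<bar>y - x\<bar> < d\<rbrakk> \<Longrightarrow> \<bar>F y - F x\<bar> < e / 2"
      by (auto simp: dist_real_def)
    have "(\<lambda>n. (b - a) / real n) \<longlonglongrightarrow> 0"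
      by (intro real_tendsto_divide_at_top[OF tendsto_const] filterlim_real_sequentially)
    then have "\<forall>\<^sub>F n in sequentially. (b - a) / real n < d"
      using d(1) by (rule order_tendstoD)
    then show "\<forall>\<^sub>F n in sequentially. dist (Sup (A n)) 0 < e"
    proof eventually_elim
      case (elim n)
      have "Sup (A n) \<le> e / 2"
      proof (rule cSup_least)
        show "A n \<noteq> {}" using A0[of n] by blast
        fix z assume "z \<in> A n"
        then obtain x y where "z = \<bar>F x - F y\<bar>" "x \<in> {a..b}" "y \<in> {a..b}" "\<bar>x - y\<bar> \<le> (b - a) / real n"
          by (auto simp: A_def)
        with d(2)[of y x] elim show "z \<le> e / 2" by linarith
      qed
      moreover have "0 \<le> Sup (A n)" by (intro cSup_upper A0 bdd)
      ultimately show ?case using \<open>0 < e\<close> by simp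
    qed
  qed
qed

section \<open>Convergence of the distribution functions\<close>

theorem theorem4p1:
  fixes M :: "'a measure" and X :: "'a \<Rightarrow> real" and F :: "real \<Rightarrow> real" and q0 qn :: real
  assumes "X \<in> L2_tails_class M"
    and "F = rv_cdf M X"
    and "q0 < qn"
    and "L2_tails_at F q0 qn"
  shows "\<exists>f :: nat \<Rightarrow> nat \<Rightarrow> real \<Rightarrow> real.
     (\<forall>N. \<forall>n\<ge>1. is_pdf (f N n) \<and> three_segment N n q0 qn (f N n)) \<and>
     (\<forall>N. \<forall>n\<ge>1. L2_on UNIV (\<lambda>x. F x - (LINT t:{..x}|lborel. f N n t))) \<and>
     ((\<lambda>(N, n). L2_norm_on UNIV (\<lambda>x. F x - (LINT t:{..x}|lborel. f N n t)))
        \<longlongrightarrow> 0) (sequentially \<times>\<^sub>F sequentially) \<and>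
     (\<forall>x. ((\<lambda>(N, n). F x - (LINT t:{..x}|lborel. f N n t))
        \<longlongrightarrow> 0) (sequentially \<times>\<^sub>F sequentially))"
proof -
  have rv: "continuous_rv M X"
    using assms(1) by (simp add: L2_tails_class_def)
  then interpret prob_space M
    by (simp add: continuous_rv_def)
  have "X \<in> borel_measurable M" and F_cont: "continuous_on UNIV F"
    using rv by (simp_all add: continuous_rv_def assms(2))
  then interpret D: real_distribution "distr M borel X"
    by (intro real_distribution_distr)
  have F: "F x = cdf (distr M borel X) x" for x
    by (simp add: assms(2) rv_cdf_def)
  have F_bounds: "0 \<le> F x" "F x \<le> 1" for x
    unfolding F by (rule D.cdf_nonneg D.cdf_bounded_prob)+
  have "mono F"
    unfolding F[abs_def] by (intro monoI D.cdf_nondecreasing)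
  note F_mono = monoD[OF this]
  have [measurable]: "F \<in> borel_measurable borel"
    by (rule borel_measurable_mono[OF \<open>mono F\<close>])

  obtain \<delta> where "0 < \<delta>" and L2: "set_integrable lborel {..<q0 + \<delta>} (\<lambda>x. (F x)\<^sup>2)"
    "set_integrable lborel {qn - \<delta><..} (\<lambda>x. (1 - F x)\<^sup>2)"
    using assms(4) unfolding L2_tails_at_def L2_on_def by blast
  \<comment> \<open>The changes of variables \<open>q0 - x\<close> and, below, \<open>x - qn\<close>
    carry each tail to the half line \<open>{0..}\<close>.\<close>
  have reflect: "integrable lborel (\<lambda>x. indicator {..q0} x * h (q0 - x)) \<longleftrightarrow> set_integrable lborel {0..} h"
    "(LINT x|lborel. indicator {..q0} x * h (q0 - x)) = (LINT x:{0..}|lborel. h x)" for h :: "real \<Rightarrow> real"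
  proof -
    have "indicator {0..} (q0 + - 1 * x) = (indicator {..q0} x :: real)" for x
      by (auto simp: indicator_def)
    then show "integrable lborel (\<lambda>x. indicator {..q0} x * h (q0 - x)) \<longleftrightarrow> set_integrable lborel {0..} h"
      "(LINT x|lborel. indicator {..q0} x * h (q0 - x)) = (LINT x:{0..}|lborel. h x)"
      using lborel_integrable_real_affine_iff[of "- 1" "\<lambda>x. indicator {0..} x *\<^sub>R h x" q0]
        lborel_integral_real_affine[of "- 1" "\<lambda>x. indicator {0..} x *\<^sub>R h x" q0]
      by (simp_all add: set_integrable_def set_lebesgue_integral_def)
  qed
  have shift: "integrable lborel (\<lambda>x. indicator {qn..} x * h (x - qn)) \<longleftrightarrow> set_integrable lborel {0..} h"
    "(LINT x|lborel. indicator {qn..} x * h (x - qn)) = (LINT x:{0..}|lborel. h x)" for h :: "real \<Rightarrow> real"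
  proof -
    have "indicator {0..} (- qn + 1 * x) = (indicator {qn..} x :: real)" for x
      by (auto simp: indicator_def)
    then show "integrable lborel (\<lambda>x. indicator {qn..} x * h (x - qn)) \<longleftrightarrow> set_integrable lborel {0..} h"
      "(LINT x|lborel. indicator {qn..} x * h (x - qn)) = (LINT x:{0..}|lborel. h x)"
      using lborel_integrable_real_affine_iff[of 1 "\<lambda>x. indicator {0..} x *\<^sub>R h x" "- qn"]
        lborel_integral_real_affine[of 1 "\<lambda>x. indicator {0..} x *\<^sub>R h x" "- qn"]
      by (simp_all add: set_integrable_def set_lebesgue_integral_def)
  qed

  \<comment> \<open>Using \<open>F\<close> itself also for negative arguments makes both functions
    monotone and continuous on the whole line, as \<open>tail_approximation\<close>
    requires.\<close>
  define Tl where "Tl y = F (q0 - y)" for y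
  define Tr where "Tr y = 1 - F (qn + y)" for y
  have Tl_int: "set_integrable lborel {0..} (\<lambda>x. (Tl x)\<^sup>2)"
  proof -
    have "set_integrable lborel {..q0} (\<lambda>x. (F x)\<^sup>2)"
      using L2(1) by (rule set_integrable_subset) (use \<open>0 < \<delta>\<close> in auto)
    then show ?thesis
      by (subst reflect(1)[symmetric]) (simp add: Tl_def set_integrable_def)
  qed
  have Tr_int: "set_integrable lborel {0..} (\<lambda>x. (Tr x)\<^sup>2)"
  proof -
    have "set_integrable lborel {qn..} (\<lambda>x. (1 - F x)\<^sup>2)"
      using L2(2) by (rule set_integrable_subset) (use \<open>0 < \<delta>\<close> in auto)
    then show ?thesis
      by (subst shift(1)[symmetric]) (simp add: Tr_def set_integrable_def)
  qed
  have T_cont: "continuous_on UNIV Tl" "continuous_on UNIV Tr"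
    unfolding Tl_def Tr_def
    by (intro continuous_intros continuous_on_compose2[OF F_cont]; simp)+
  have T_mono: "x \<le> y \<Longrightarrow> Tl y \<le> Tl x" "x \<le> y \<Longrightarrow> Tr y \<le> Tr x" for x y
    unfolding Tl_def Tr_def by (simp_all add: F_mono)
  have T_nonneg: "0 \<le> Tl x" "0 \<le> Tr x" for x
    unfolding Tl_def Tr_def using F_bounds by simp_all
  obtain gl Gl where gl:
    "\<And>N. \<exists>p \<sigma>. degree p \<le> N \<and> 0 < \<sigma> \<and> gl N = (\<lambda>t. poly p t * normal_density 0 \<sigma> t)"
    "\<And>N t. 0 \<le> t \<Longrightarrow> 0 \<le> gl N t"
    "\<And>N x. 0 \<le> x \<Longrightarrow> has_bochner_integral lborel (\<lambda>t. indicator {x..} t * gl N t) (Gl N x)"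
    "\<And>N. Gl N 0 = Tl 0"
    "\<And>N. set_integrable lborel {0..} (\<lambda>x. (Gl N x - Tl x)\<^sup>2)"
    "\<And>x. 0 \<le> x \<Longrightarrow> (\<lambda>N. Gl N x) \<longlonglongrightarrow> Tl x"
    "(\<lambda>N. LINT x:{0..}|lborel. (Gl N x - Tl x)\<^sup>2) \<longlonglongrightarrow> 0"
    by (rule tail_approximation[OF T_mono(1) T_nonneg(1) T_cont(1) Tl_int]) (assumption, rule that)
  obtain gr Gr where gr:
    "\<And>N. \<exists>p \<sigma>. degree p \<le> N \<and> 0 < \<sigma> \<and> gr N = (\<lambda>t. poly p t * normal_density 0 \<sigma> t)"
    "\<And>N t. 0 \<le> t \<Longrightarrow> 0 \<le> gr N t"
    "\<And>N x. 0 \<le> x \<Longrightarrow> has_bochner_integral lborel (\<lambda>t. indicator {x..} t * gr N t) (Gr N x)"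
    "\<And>N. Gr N 0 = Tr 0"
    "\<And>N. set_integrable lborel {0..} (\<lambda>x. (Gr N x - Tr x)\<^sup>2)"
    "\<And>x. 0 \<le> x \<Longrightarrow> (\<lambda>N. Gr N x) \<longlonglongrightarrow> Tr x"
    "(\<lambda>N. LINT x:{0..}|lborel. (Gr N x - Tr x)\<^sup>2) \<longlonglongrightarrow> 0"
    by (rule tail_approximation[OF T_mono(2) T_nonneg(2) T_cont(2) Tr_int]) (assumption, rule that)
  obtain \<omega> where \<omega>: "\<omega> \<longlonglongrightarrow> 0"
    "\<And>n x y. \<lbrakk>x \<in> {q0..qn}; y \<in> {q0..qn}; \<bar>x - y\<bar> \<le> (qn - q0) / real n\<rbrakk> \<Longrightarrow> \<bar>F x - F y\<bar> \<le> \<omega> n"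
    by (rule uniform_oscillation[OF assms(3) continuous_on_subset[OF F_cont subset_UNIV]]) (rule that)

  define Q where "Q N n f \<longleftrightarrow> is_pdf f \<and> three_segment N n q0 qn f \<and> mono (\<lambda>x. LINT t:{..x}|lborel. f t) \<and>
      (\<forall>x\<le>q0. (LINT t:{..x}|lborel. f t) = Gl N (q0 - x)) \<and>
      (\<forall>i\<le>n. (LINT t:{..knot q0 qn n i}|lborel. f t) = F (knot q0 qn n i)) \<and>
      (\<forall>x\<ge>qn. (LINT t:{..x}|lborel. f t) = 1 - Gr N (x - qn))" for N n f
  have Q_ex: "\<exists>f. Q N n f" if "1 \<le> n" for N n
  proof -
    have n: "0 < n" using that by simp
    have ends: "Gl N 0 = F q0" "Gr N 0 = 1 - F qn" by (simp_all add: gl(4) gr(4) Tl_def Tr_def)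
    show ?thesis
      unfolding Q_def
      by (rule three_segment_assembly[OF assms(3) n \<open>mono F\<close> gl(1)[of N] gl(2)[of _ N] gl(3)[of _ N] ends(1)
          gr(1)[of N] gr(2)[of _ N] gr(3)[of _ N] ends(2)])
        (assumption | blast)+
  qed
  have Q_some: "Q N n (SOME f. Q N n f)" if "1 \<le> n" for N n
    by (rule someI_ex[OF Q_ex[OF that]])
  \<comment> \<open>For \<open>n = 0\<close> the choice is unconstrained, hence the guard
    \<open>1 \<le> n\<close> in all that follows.\<close>
  define f where "f N n = (SOME f. Q N n f)" for N n
  have f: "is_pdf (f N n)" "three_segment N n q0 qn (f N n)"
    "mono (\<lambda>x. LINT t:{..x}|lborel. f N n t)"
    "x \<le> q0 \<Longrightarrow> (LINT t:{..x}|lborel. f N n t) = Gl N (q0 - x)"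
    "i \<le> n \<Longrightarrow> (LINT t:{..knot q0 qn n i}|lborel. f N n t) = F (knot q0 qn n i)"
    "qn \<le> x \<Longrightarrow> (LINT t:{..x}|lborel. f N n t) = 1 - Gr N (x - qn)" if "1 \<le> n" for N n x i
    using Q_some[OF that, of N] unfolding f_def[symmetric] by (simp_all add: Q_def)

  \<comment> \<open>Error of the distribution function on the three segments\<close>
  define E where "E N n x = F x - (LINT t:{..x}|lborel. f N n t)" for N n x
  have E_left: "E N n x = Tl (q0 - x) - Gl N (q0 - x)" if "1 \<le> n" "x \<le> q0" for N n x
    using that by (simp add: E_def f(4) Tl_def)
  have E_right: "E N n x = Gr N (x - qn) - Tr (x - qn)" if "1 \<le> n" "qn \<le> x" for N n x
    using that by (simp add: E_def f(6) Tr_def)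
  have E_mid: "\<bar>E N n x\<bar> \<le> \<omega> n" if n: "1 \<le> n" and x: "q0 \<le> x" "x \<le> qn" for N n x
  proof -
    define u v where "u i = knot q0 qn n i" and "v = (\<lambda>x. LINT t:{..x}|lborel. f N n t)" for i
    obtain i where i: "i < n" "u i \<le> x" "x \<le> u (Suc i)"
      using knot_cover[OF x assms(3), of n] n by (auto simp: u_def)
    have "v (u i) \<le> v x" "v x \<le> v (u (Suc i))"
      using monoD[OF f(3)[OF n, of N]] i unfolding v_def by blast+
    moreover have "v (u i) = F (u i)" "v (u (Suc i)) = F (u (Suc i))"
      using i n by (simp_all add: v_def u_def f(5))
    moreover have "F (u i) \<le> F x" "F x \<le> F (u (Suc i))"
      using i by (simp_all add: F_mono)
    moreover have "\<bar>F (u (Suc i)) - F (u i)\<bar> \<le> \<omega> n"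
    proof (rule \<omega>(2))
      have "knot q0 qn n 0 = q0" "knot q0 qn n n = qn"
        using n by (simp_all add: knot_def)
      then show "u (Suc i) \<in> {q0..qn}" "u i \<in> {q0..qn}"
        using knot_le[OF assms(3), of _ _ n] i(1) unfolding u_def
        by (metis Suc_leI atLeastAtMost_iff le0 less_imp_le)+
      show "\<bar>u (Suc i) - u i\<bar> \<le> (qn - q0) / real n"
      proof -
        have "u (Suc i) - u i = (qn - q0) / real n"
          by (simp only: u_def knot_def of_nat_Suc distrib_right mult_1_left add_diff_cancel_left add_diff_cancel_right')
        then show ?thesis using assms(3) by simp
      qed
    qed
    moreover have "E N n x = F x - v x" by (simp add: E_def v_def)
    ultimately show ?thesis by linarith
  qed

  define A where "A N = (LINT x:{0..}|lborel. (Gl N x - Tl x)\<^sup>2)" for N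
  define B where "B N = (LINT x:{0..}|lborel. (Gr N x - Tr x)\<^sup>2)" for N
  \<comment> \<open>The majorant separates the indices: the tail terms depend on \<open>N\<close>
    only, the middle term on \<open>n\<close> only. Double counting at \<open>q0\<close> and
    \<open>qn\<close> is harmless, since all terms are nonnegative and only an upper bound is
    sought.\<close>
  define bound where "bound N n x = indicator {..q0} x * (Gl N (q0 - x) - Tl (q0 - x))\<^sup>2
      + indicator {qn..} x * (Gr N (x - qn) - Tr (x - qn))\<^sup>2 + indicator {q0..qn} x * (\<omega> n)\<^sup>2" for N n x
  have bound_int: "has_bochner_integral lborel (bound N n) (A N + B N + (qn - q0) * (\<omega> n)\<^sup>2)" for N n
    unfolding bound_def
  proof (intro has_bochner_integral_add has_bochner_integral_mult_left)
    show "has_bochner_integral lborel (\<lambda>x. indicator {..q0} x * (Gl N (q0 - x) - Tl (q0 - x))\<^sup>2) (A N)"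
      using gl(5)[of N] by (simp add: has_bochner_integral_iff A_def reflect[of "\<lambda>x. (Gl N x - Tl x)\<^sup>2"])
    show "has_bochner_integral lborel (\<lambda>x. indicator {qn..} x * (Gr N (x - qn) - Tr (x - qn))\<^sup>2) (B N)"
      using gr(5)[of N] by (simp add: has_bochner_integral_iff B_def shift[of "\<lambda>x. (Gr N x - Tr x)\<^sup>2"])
    show "has_bochner_integral lborel (indicator {q0..qn}) (qn - q0)"
      using has_bochner_integral_real_indicator[of "{q0..qn}" lborel] assms(3) by simp
  qed
  have E_le: "(E N n x)\<^sup>2 \<le> bound N n x" if "1 \<le> n" for N n x
  proof -
    have parts: "0 \<le> indicator {..q0} x * (Gl N (q0 - x) - Tl (q0 - x))\<^sup>2"
      "0 \<le> indicator {qn..} x * (Gr N (x - qn) - Tr (x - qn))\<^sup>2" "0 \<le> indicator {q0..qn} x * (\<omega> n)\<^sup>2"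
      by simp_all
    consider "x \<le> q0" | "qn \<le> x" | "q0 \<le> x" "x \<le> qn" by linarith
    then show ?thesis
    proof cases
      case 1
      then show ?thesis using parts that by (simp add: bound_def E_left power2_commute)
    next
      case 2
      then show ?thesis using parts that by (simp add: bound_def E_right)
    next
      case 3
      then have "(E N n x)\<^sup>2 \<le> indicator {q0..qn} x * (\<omega> n)\<^sup>2"
        using power_mono[OF E_mid[OF that 3, of N], of 2] by simp
      then show ?thesis using parts unfolding bound_def by linarith
    qed
  qed
  have E_meas[measurable]: "E N n \<in> borel_measurable borel" if "1 \<le> n" for N n
    unfolding E_def[abs_def] using borel_measurable_mono[OF f(3)[OF that]] by measurable
  have E_int: "integrable lborel (\<lambda>x. (E N n x)\<^sup>2)" if "1 \<le> n" for N n
  proof (rule Bochner_Integration.integrable_bound[OF integrable.intros[OF bound_int]])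
    show "(\<lambda>x. (E N n x)\<^sup>2) \<in> borel_measurable lborel" using E_meas[OF that] by measurable
    show "AE x in lborel. norm ((E N n x)\<^sup>2) \<le> norm (bound N n x)"
      by (intro AE_I2) (use order_trans[OF E_le[OF that] abs_ge_self] in simp)
  qed
  have norm_le: "L2_norm_on UNIV (E N n) \<le> sqrt (A N + B N + (qn - q0) * (\<omega> n)\<^sup>2)" if "1 \<le> n" for N n
  proof -
    have "(LINT x|lborel. (E N n x)\<^sup>2) \<le> (LINT x|lborel. bound N n x)"
      by (intro integral_mono E_int that E_le integrable.intros[OF bound_int])
    then show ?thesis
      using has_bochner_integral_integral_eq[OF bound_int[of N n]]
      by (simp add: L2_norm_on_def set_lebesgue_integral_def)
  qed

  \<comment> \<open>Joint limits in the degree and the number of subintervals\<close>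
  have fst_lim: "((\<lambda>(N, n). h N) \<longlongrightarrow> l) (sequentially \<times>\<^sub>F sequentially)"
    if "h \<longlonglongrightarrow> l" for h :: "nat \<Rightarrow> real" and l
    using filterlim_compose[OF that filterlim_fst] by (simp add: case_prod_beta')
  have snd_lim: "((\<lambda>(N, n). h n) \<longlongrightarrow> l) (sequentially \<times>\<^sub>F sequentially)"
    if "h \<longlonglongrightarrow> l" for h :: "nat \<Rightarrow> real" and l
    using filterlim_compose[OF that filterlim_snd] by (simp add: case_prod_beta')
  have ev: "\<forall>\<^sub>F (N, n) in sequentially \<times>\<^sub>F sequentially. 1 \<le> (n::nat)"
    by (auto simp: eventually_prod_sequentially)

  have "((\<lambda>(N, n). L2_norm_on UNIV (E N n)) \<longlongrightarrow> 0) (sequentially \<times>\<^sub>F sequentially)"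
  proof (rule tendsto_sandwich[OF _ _ tendsto_const])
    have "((\<lambda>p. sqrt ((case p of (N, n) \<Rightarrow> A N) + (case p of (N, n) \<Rightarrow> B N)
          + (qn - q0) * (case p of (N, n) \<Rightarrow> \<omega> n)\<^sup>2)) \<longlongrightarrow> sqrt (0 + 0 + (qn - q0) * 0\<^sup>2))
        (sequentially \<times>\<^sub>F sequentially)"
      using gl(7) gr(7) \<omega>(1) unfolding A_def[symmetric] B_def[symmetric]
      by (intro tendsto_intros fst_lim snd_lim)
    then show "((\<lambda>(N, n). sqrt (A N + B N + (qn - q0) * (\<omega> n)\<^sup>2)) \<longlongrightarrow> 0)
        (sequentially \<times>\<^sub>F sequentially)"
      by (simp add: case_prod_beta')
    show "\<forall>\<^sub>F p in sequentially \<times>\<^sub>F sequentially. (case p of (N, n) \<Rightarrow> L2_norm_on UNIV (E N n))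
        \<le> (case p of (N, n) \<Rightarrow> sqrt (A N + B N + (qn - q0) * (\<omega> n)\<^sup>2))"
      using ev by eventually_elim (auto intro: norm_le)
    show "\<forall>\<^sub>F p in sequentially \<times>\<^sub>F sequentially. 0 \<le> (case p of (N, n) \<Rightarrow> L2_norm_on UNIV (E N n))"
      by (intro always_eventually)
        (auto simp: L2_norm_on_def set_lebesgue_integral_def intro!: integral_nonneg_AE)
  qed
  moreover have "((\<lambda>(N, n). E N n x) \<longlongrightarrow> 0) (sequentially \<times>\<^sub>F sequentially)" for x
  proof -
    \<comment> \<open>On the tails the error is governed by \<open>N\<close> alone and in between by
      \<open>n\<close> alone, so a single-index limit suffices in each case, without any coupling of
      \<open>N\<close> and \<open>n\<close>.\<close>
    consider "x \<le> q0" | "qn \<le> x" | "q0 \<le> x" "x \<le> qn" by linarith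
    then obtain h where h: "(h \<longlongrightarrow> 0) (sequentially \<times>\<^sub>F sequentially)"
      and le: "\<And>N n. 1 \<le> n \<Longrightarrow> \<bar>E N n x\<bar> \<le> h (N, n)"
    proof cases
      case 1
      have "(\<lambda>N. \<bar>Tl (q0 - x) - Gl N (q0 - x)\<bar>) \<longlonglongrightarrow> \<bar>Tl (q0 - x) - Tl (q0 - x)\<bar>"
        using 1 by (intro tendsto_intros gl(6)) simp
      then show thesis
        using 1 by (intro that[OF fst_lim[of "\<lambda>N. \<bar>Tl (q0 - x) - Gl N (q0 - x)\<bar>"]]) (auto simp: E_left)
    next
      case 2
      have "(\<lambda>N. \<bar>Gr N (x - qn) - Tr (x - qn)\<bar>) \<longlonglongrightarrow> \<bar>Tr (x - qn) - Tr (x - qn)\<bar>"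
        using 2 by (intro tendsto_intros gr(6)) simp
      then show thesis
        using 2 by (intro that[OF fst_lim[of "\<lambda>N. \<bar>Gr N (x - qn) - Tr (x - qn)\<bar>"]]) (auto simp: E_right)
    next
      case 3
      then show thesis
        by (intro that[OF snd_lim[OF \<omega>(1)]]) (auto simp: E_mid)
    qed
    show ?thesis
      by (rule Lim_null_comparison[OF _ h], use ev in eventually_elim) (auto intro: le)
  qed
  moreover have "L2_on UNIV (E N n)" if "1 \<le> n" for N n
    using E_int[OF that] E_meas[OF that]
    by (simp add: L2_on_def set_integrable_def set_borel_measurable_def)
  ultimately show ?thesis
    using f(1,2) unfolding E_def[abs_def] by (intro exI[of _ f]) auto
qed

end
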